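(* For a commutative ring $R$ the following statements are equivalent: (1) $R$ is a $\Pi_2$ ring, i.e., each $A\in Um(\mathbb{M}_2(R))$ with $\det(A)=0$ is extendable. (2) Each matrix in $Um(\mathbb{M}_2(R))$ of zero determinant is non-full, i.e., is the product of two matrices of sizes $2\times 1$ and $1\times 2$ with entries in $R$ (equivalently, the $R$-linear map $L_A$ factors as a composite of $R$-linear maps $R^2\to R\to R^2$). (3) For each matrix $A\in Um(\mathbb{M}_2(R))$ of zero determinant, one (hence both) of the $R$-modules $K_A$ and $Q_A$ is isomorphic to $R$. (4) Each projective $R$-module of rank $1$ generated by two elements is isomorphic to $R$.
   Context: Rings are commutative with identity. For a free $R$-module $F$, $Um(F)$ is the set of unimodular elements of $F$, i.e., $v\in F$ for which there is an $R$-linear map $L:F\to R$ with $L(v)=1$; thus $A\in Um(\mathbb{M}_2(R))$ iff the entries of $A$ generate the unit ideal of $R$. A matrix $A\in\mathbb{M}_2(R)$ is called extendable if there exists $A^+\in SL_3(R)$ such that $A$ is obtained from $A^+$ by removing the last row and the last column. For $A\in\mathbb{M}_2(R)$, $L_A:R^2\to R^2$ is the $R$-linear map defined by $A$ (acting on columns), $K_A$ is its kernel and $Q_A$ is its image. "Projective of rank 1" means finitely generated projective of constant rank 1. *)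

theory Defs
  imports "HOL-Algebra.Module" "HOL-Algebra.Ideal"
begin

text \<open>
  Rings are given by \<open>HOL-Algebra\<close> records satisfying \<^locale>\<open>cring\<close>, so the zero ring is
  included. In the records for modules, the fields \<^const>\<open>mult\<close> and \<^const>\<open>one\<close> are irrelevant.
\<close>

section \<open>Linear maps\<close>

definition linear_maps ::
    "('a, 'r) ring_scheme \<Rightarrow> ('a, 'm) module \<Rightarrow> ('a, 'n) module \<Rightarrow> ('m \<Rightarrow> 'n) set" where
  "linear_maps R M N =
     {f \<in> carrier M \<rightarrow> carrier N.
        (\<forall>x\<in>carrier M. \<forall>y\<in>carrier M. f (x \<oplus>\<^bsub>M\<^esub> y) = f x \<oplus>\<^bsub>N\<^esub> f y) \<and>
        (\<forall>a\<in>carrier R. \<forall>x\<in>carrier M. f (a \<odot>\<^bsub>M\<^esub> x) = a \<odot>\<^bsub>N\<^esub> f x)}"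

definition module_iso ::
    "('a, 'r) ring_scheme \<Rightarrow> ('a, 'm) module \<Rightarrow> ('a, 'n) module \<Rightarrow> bool" where
  "module_iso R M N \<longleftrightarrow> (\<exists>f\<in>linear_maps R M N. bij_betw f (carrier M) (carrier N))"

definition self_module :: "('a, 'r) ring_scheme \<Rightarrow> ('a, 'a) module" where
  "self_module R = \<lparr>carrier = carrier R, mult = mult R, one = one R, zero = zero R,
                    add = add R, smult = mult R\<rparr>"

text \<open>
  The free module with basis indexed by \<open>I\<close>: finitely supported families. A family is extended
  by \<open>\<zero>\<close> outside \<open>I\<close>, so that equality in the module is equality of functions.
\<close>

definition free_module :: "('a, 'r) ring_scheme \<Rightarrow> 'i set \<Rightarrow> ('a, 'i \<Rightarrow> 'a) module" where
  "free_module R I =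
     \<lparr>carrier = {v. (\<forall>i\<in>I. v i \<in> carrier R) \<and> (\<forall>i. i \<notin> I \<longrightarrow> v i = \<zero>\<^bsub>R\<^esub>) \<and>
                    finite {i. v i \<noteq> \<zero>\<^bsub>R\<^esub>}},
      mult = undefined, one = undefined,
      zero = (\<lambda>_. \<zero>\<^bsub>R\<^esub>),
      add = (\<lambda>v w i. v i \<oplus>\<^bsub>R\<^esub> w i),
      smult = (\<lambda>a v i. a \<otimes>\<^bsub>R\<^esub> v i)\<rparr>"

definition Um :: "('a, 'r) ring_scheme \<Rightarrow> ('a, 'm) module \<Rightarrow> 'm set" where
  "Um R F = {v \<in> carrier F. \<exists>L\<in>linear_maps R F (self_module R). L v = \<one>\<^bsub>R\<^esub>}"

definition generated_submodule ::
    "('a, 'r) ring_scheme \<Rightarrow> ('a, 'm) module \<Rightarrow> 'm set \<Rightarrow> 'm set" where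
  "generated_submodule R M S = \<Inter>{H. submodule H R M \<and> S \<subseteq> H}"

definition finitely_generated :: "('a, 'r) ring_scheme \<Rightarrow> ('a, 'm) module \<Rightarrow> bool" where
  "finitely_generated R M \<longleftrightarrow>
     (\<exists>S. finite S \<and> S \<subseteq> carrier M \<and> generated_submodule R M S = carrier M)"

text \<open>
  A module with two generators is a quotient of \<open>R\<^sup>2\<close>, so every such module has an isomorphic
  copy whose elements are of type \<^typ>\<open>nat \<Rightarrow> 'a\<close>, the element type of \<open>R\<^sup>2\<close> below.
\<close>

definition generated_by_two :: "('a, 'r) ring_scheme \<Rightarrow> ('a, 'm) module \<Rightarrow> bool" where
  "generated_by_two R M \<longleftrightarrow>
     (\<exists>x\<in>carrier M. \<exists>y\<in>carrier M. generated_submodule R M {x, y} = carrier M)"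

text \<open>
  A module is projective iff it is (isomorphic to) a direct summand of a free module. Index sets
  in the type of elements of \<open>M\<close> suffice: if \<open>M\<close> is a summand of any free module, then the
  canonical surjection from the free module on \<^term>\<open>carrier M\<close> splits.
\<close>

definition projective :: "('a, 'r) ring_scheme \<Rightarrow> ('a, 'm) module \<Rightarrow> bool" where
  "projective R M \<longleftrightarrow> module R M \<and>
     (\<exists>I :: 'm set. \<exists>s\<in>linear_maps R M (free_module R I). \<exists>p\<in>linear_maps R (free_module R I) M.
        \<forall>x\<in>carrier M. p (s x) = x)"


section \<open>Localization and rank\<close>

text \<open>\<open>S\<close> is a multiplicative set; the fraction \<open>m/s\<close> is the class of \<open>(m, s)\<close>.\<close>

definition frac_rel ::
    "('a, 'r) ring_scheme \<Rightarrow> 'a set \<Rightarrow> ('a, 'm) module \<Rightarrow> (('m \<times> 'a) \<times> ('m \<times> 'a)) set" where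
  "frac_rel R S M =
     {((m, s), (n, t)). m \<in> carrier M \<and> n \<in> carrier M \<and> s \<in> S \<and> t \<in> S \<and>
        (\<exists>u\<in>S. u \<odot>\<^bsub>M\<^esub> (t \<odot>\<^bsub>M\<^esub> m) = u \<odot>\<^bsub>M\<^esub> (s \<odot>\<^bsub>M\<^esub> n))}"

definition fraction ::
    "('a, 'r) ring_scheme \<Rightarrow> 'a set \<Rightarrow> ('a, 'm) module \<Rightarrow> 'm \<Rightarrow> 'a \<Rightarrow> ('m \<times> 'a) set" where
  "fraction R S M m s = frac_rel R S M `` {(m, s)}"

text \<open>
  The operations below take a union over all representatives of the two fractions; all members of
  the union coincide. Scalars of the localized module are elements of the localized ring.
\<close>

definition loc_module ::
    "('a, 'r) ring_scheme \<Rightarrow> 'a set \<Rightarrow> ('a, 'm) module \<Rightarrow> (('a \<times> 'a) set, ('m \<times> 'a) set) module"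
  where
  "loc_module R S M =
     \<lparr>carrier = {fraction R S M m s | m s. m \<in> carrier M \<and> s \<in> S},
      mult = undefined, one = undefined,
      zero = fraction R S M \<zero>\<^bsub>M\<^esub> \<one>\<^bsub>R\<^esub>,
      add = (\<lambda>X Y. \<Union>(m, s)\<in>X. \<Union>(n, t)\<in>Y.
               fraction R S M ((t \<odot>\<^bsub>M\<^esub> m) \<oplus>\<^bsub>M\<^esub> (s \<odot>\<^bsub>M\<^esub> n)) (s \<otimes>\<^bsub>R\<^esub> t)),
      smult = (\<lambda>X Y. \<Union>(a, s)\<in>X. \<Union>(m, t)\<in>Y. fraction R S M (a \<odot>\<^bsub>M\<^esub> m) (s \<otimes>\<^bsub>R\<^esub> t))\<rparr>"

definition loc_ring :: "('a, 'r) ring_scheme \<Rightarrow> 'a set \<Rightarrow> ('a \<times> 'a) set ring" where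
  "loc_ring R S =
     (let L = loc_module R S (self_module R) in
      \<lparr>carrier = carrier L, mult = smult L, one = fraction R S (self_module R) \<one>\<^bsub>R\<^esub> \<one>\<^bsub>R\<^esub>,
       zero = zero L, add = add L\<rparr>)"

definition has_constant_rank :: "('a, 'r) ring_scheme \<Rightarrow> ('a, 'm) module \<Rightarrow> nat \<Rightarrow> bool" where
  "has_constant_rank R M n \<longleftrightarrow>
     (\<forall>P. primeideal P R \<longrightarrow>
        (let S = carrier R - P in
         module_iso (loc_ring R S) (loc_module R S M) (free_module (loc_ring R S) {..<n})))"

definition projective_of_rank :: "('a, 'r) ring_scheme \<Rightarrow> ('a, 'm) module \<Rightarrow> nat \<Rightarrow> bool" where
  "projective_of_rank R M n \<longleftrightarrow>
     projective R M \<and> finitely_generated R M \<and> has_constant_rank R M n"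


section \<open>Matrices\<close>

text \<open>
  Indices start at 0, and the free module convention above applies: a matrix is \<open>\<zero>\<close>
  outside its index range.
\<close>

definition mat_module :: "('a, 'r) ring_scheme \<Rightarrow> nat \<Rightarrow> nat \<Rightarrow> ('a, nat \<times> nat \<Rightarrow> 'a) module" where
  "mat_module R m n = free_module R ({..<m} \<times> {..<n})"

text \<open>The argument \<open>k\<close> is the inner dimension.\<close>

definition mat_mult ::
    "('a, 'r) ring_scheme \<Rightarrow> nat \<Rightarrow> (nat \<times> nat \<Rightarrow> 'a) \<Rightarrow> (nat \<times> nat \<Rightarrow> 'a) \<Rightarrow> nat \<times> nat \<Rightarrow> 'a" where
  "mat_mult R k A B = (\<lambda>(i, j). \<Oplus>\<^bsub>R\<^esub>l\<in>{..<k}. A (i, l) \<otimes>\<^bsub>R\<^esub> B (l, j))"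

text \<open>The determinant of an \<open>n \<times> n\<close> matrix, by Laplace expansion along the first row.\<close>

primrec mat_det :: "('a, 'r) ring_scheme \<Rightarrow> nat \<Rightarrow> (nat \<times> nat \<Rightarrow> 'a) \<Rightarrow> 'a" where
  "mat_det R 0 A = \<one>\<^bsub>R\<^esub>"
| "mat_det R (Suc n) A =
     (\<Oplus>\<^bsub>R\<^esub>j\<in>{..n}. (\<ominus>\<^bsub>R\<^esub> \<one>\<^bsub>R\<^esub>) [^]\<^bsub>R\<^esub> j \<otimes>\<^bsub>R\<^esub> A (0, j) \<otimes>\<^bsub>R\<^esub>
        mat_det R n (\<lambda>(i, k). A (Suc i, if k < j then k else Suc k)))"

definition Um_det_zero :: "('a, 'r) ring_scheme \<Rightarrow> (nat \<times> nat \<Rightarrow> 'a) set" where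
  "Um_det_zero R = {A \<in> Um R (mat_module R 2 2). mat_det R 2 A = \<zero>\<^bsub>R\<^esub>}"

definition SL :: "('a, 'r) ring_scheme \<Rightarrow> nat \<Rightarrow> (nat \<times> nat \<Rightarrow> 'a) set" where
  "SL R n = {A \<in> carrier (mat_module R n n). mat_det R n A = \<one>\<^bsub>R\<^esub>}"

definition extendable :: "('a, 'r) ring_scheme \<Rightarrow> (nat \<times> nat \<Rightarrow> 'a) \<Rightarrow> bool" where
  "extendable R A \<longleftrightarrow> (\<exists>A'\<in>SL R 3. \<forall>i<2. \<forall>j<2. A (i, j) = A' (i, j))"

definition Pi2_ring :: "('a, 'r) ring_scheme \<Rightarrow> bool" where
  "Pi2_ring R \<longleftrightarrow> cring R \<and> (\<forall>A\<in>Um_det_zero R. extendable R A)"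

definition non_full :: "('a, 'r) ring_scheme \<Rightarrow> (nat \<times> nat \<Rightarrow> 'a) \<Rightarrow> bool" where
  "non_full R A \<longleftrightarrow>
     (\<exists>B\<in>carrier (mat_module R 2 1). \<exists>C\<in>carrier (mat_module R 1 2). A = mat_mult R 1 B C)"

text \<open>The map \<open>L\<^sub>A\<close>, its kernel \<open>K\<^sub>A\<close> and its image \<open>Q\<^sub>A\<close>, for a \<open>2 \<times> 2\<close> matrix \<open>A\<close>.\<close>

definition L_map :: "('a, 'r) ring_scheme \<Rightarrow> (nat \<times> nat \<Rightarrow> 'a) \<Rightarrow> (nat \<Rightarrow> 'a) \<Rightarrow> nat \<Rightarrow> 'a" where
  "L_map R A v = (\<lambda>i. \<Oplus>\<^bsub>R\<^esub>j\<in>{..<2}. A (i, j) \<otimes>\<^bsub>R\<^esub> v j)"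

definition K_module :: "('a, 'r) ring_scheme \<Rightarrow> (nat \<times> nat \<Rightarrow> 'a) \<Rightarrow> ('a, nat \<Rightarrow> 'a) module" where
  "K_module R A = (free_module R {..<2})
     \<lparr>carrier := {v \<in> carrier (free_module R {..<2}). L_map R A v = \<zero>\<^bsub>free_module R {..<2::nat}\<^esub>}\<rparr>"

definition Q_module :: "('a, 'r) ring_scheme \<Rightarrow> (nat \<times> nat \<Rightarrow> 'a) \<Rightarrow> ('a, nat \<Rightarrow> 'a) module" where
  "Q_module R A = (free_module R {..<2})
     \<lparr>carrier := L_map R A ` carrier (free_module R {..<2})\<rparr>"

text \<open>
  The map \<open>L\<^sub>A\<close> factors as a composite of linear maps \<open>R\<^sup>2 \<rightarrow> R \<rightarrow> R\<^sup>2\<close>.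
\<close>

definition factors_through_R :: "('a, 'r) ring_scheme \<Rightarrow> (nat \<times> nat \<Rightarrow> 'a) \<Rightarrow> bool" where
  "factors_through_R R A \<longleftrightarrow>
     (\<exists>f\<in>linear_maps R (free_module R {..<2}) (self_module R).
      \<exists>g\<in>linear_maps R (self_module R) (free_module R {..<2}).
        \<forall>v\<in>carrier (free_module R {..<2}). L_map R A v = g (f v))"

end

theory Submission
  imports Defs
begin

text \<open>
  A factorization \<open>A = u v\<^sup>T\<close> of a unimodular matrix has \<open>u\<close> and \<open>v\<close> unimodular, and Bezout coefficients
  of \<open>u\<close> and \<open>v\<close> supply the last column and the last row of an extension in \<open>SL\<^sub>3\<close>. Conversely, if
  \<open>(g, h)\<close> and \<open>(e, f)\<close> are the new row and column of an extension, then \<open>A (h, -g)\<^sup>T\<close> is unimodular,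
  and it is proportional to both columns of \<open>A\<close>. The image \<open>Q\<^sub>A = R u\<close> and the kernel
  \<open>K\<^sub>A = v\<^sup>\<bottom>\<close> are then free of rank one. If \<open>K\<^sub>A = R k\<close>, the columns of the adjugate of \<open>A\<close> are
  multiples of \<open>k\<close>, which factors the adjugate and hence \<open>A\<close>.

  The modules \<open>Q\<^sub>A\<close> are, up to isomorphism, all projective modules \<open>M\<close> of rank one with two generators.
  A dual basis \<open>f, g\<close> for generators \<open>x, y\<close> of \<open>M\<close> gives an idempotent matrix \<open>A\<close> with rows
  \<open>(f x, f y)\<close> and \<open>(g x, g y)\<close> and image isomorphic to \<open>M\<close>; as \<open>M\<close> is locally free of rank one,
  \<open>det A = 0\<close> and \<open>tr A = 1\<close> hold locally, hence globally.
\<close>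

section \<open>Linear maps\<close>

text \<open>Unimodularity together with det A = 0 says that A has rank exactly one at every prime:
  some entry is invertible there, and the columns are proportional. Hence the correspondence with
  rank one modules on two generators. The obstacle is that \<open>has_constant_rank\<close> speaks
  of isomorphisms over localized rings, whereas the matrix arguments concern elements of
  \<open>R\<close>. The bridge is an elementwise criterion: at each prime some element generates the
  module up to denominators, and every scalar that kills it is killed by a denominator. It serves
  both to establish the rank of \<open>Q_module R A\<close> and to exploit the rank of
  \<open>M\<close>. In the second use it yields denominators that kill det A and 1 - tr A; the
  annihilators of these two elements then lie in no prime ideal, so they contain 1. The relation tr
  A = 1 finally shows that A is unimodular. All properties of a single matrix are compared with
  \<open>non_full\<close>, so they are equivalent matrix by matrix and not only for the ring as a
  whole.\<close>

lemma self_module_simps [simp]: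
  "carrier (self_module R) = carrier R" "zero (self_module R) = zero R"
  "add (self_module R) = add R" "smult (self_module R) = mult R"
  by (simp_all add: self_module_def)

lemma self_module_module:
  assumes "cring R"
  shows "module R (self_module R)"
proof -
  interpret cring R by fact
  show ?thesis
  proof (rule moduleI)
    show "abelian_group (self_module R)"
      by (rule abelian_groupI)
        (auto simp: a_ac intro: bexI[of _ "\<ominus>\<^bsub>R\<^esub> _"] l_neg)
  qed (auto simp: l_distr r_distr m_assoc assms)
qed

lemma linear_mapsD:
  assumes "f \<in> linear_maps R M N"
  shows "x \<in> carrier M \<Longrightarrow> f x \<in> carrier N"
    and "x \<in> carrier M \<Longrightarrow> y \<in> carrier M \<Longrightarrow> f (x \<oplus>\<^bsub>M\<^esub> y) = f x \<oplus>\<^bsub>N\<^esub> f y"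
    and "a \<in> carrier R \<Longrightarrow> x \<in> carrier M \<Longrightarrow> f (a \<odot>\<^bsub>M\<^esub> x) = a \<odot>\<^bsub>N\<^esub> f x"
  using assms by (auto simp: linear_maps_def)

lemma linear_mapsI:
  assumes "\<And>x. x \<in> carrier M \<Longrightarrow> f x \<in> carrier N"
    and "\<And>x y. x \<in> carrier M \<Longrightarrow> y \<in> carrier M \<Longrightarrow> f (x \<oplus>\<^bsub>M\<^esub> y) = f x \<oplus>\<^bsub>N\<^esub> f y"
    and "\<And>a x. a \<in> carrier R \<Longrightarrow> x \<in> carrier M \<Longrightarrow> f (a \<odot>\<^bsub>M\<^esub> x) = a \<odot>\<^bsub>N\<^esub> f x"
  shows "f \<in> linear_maps R M N"
  using assms by (auto simp: linear_maps_def)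

lemma linear_maps_comp:
  assumes "f \<in> linear_maps R M N" "g \<in> linear_maps R N P"
  shows "(\<lambda>x. g (f x)) \<in> linear_maps R M P"
  using assms by (auto simp: linear_maps_def Pi_def)

lemma module_iso_trans:
  assumes "module_iso R M N" "module_iso R N P"
  shows "module_iso R M P"
  using assms linear_maps_comp bij_betw_trans unfolding module_iso_def comp_def by blast

text \<open>Closure of the carrier is all that the inverse of an isomorphism needs to be linear, so
  this applies to the localized modules, which are not shown to be modules.\<close>

lemma module_iso_sym:
  assumes "module_iso R M N"
    and "\<And>x y. x \<in> carrier M \<Longrightarrow> y \<in> carrier M \<Longrightarrow> x \<oplus>\<^bsub>M\<^esub> y \<in> carrier M"
    and "\<And>a x. a \<in> carrier R \<Longrightarrow> x \<in> carrier M \<Longrightarrow> a \<odot>\<^bsub>M\<^esub> x \<in> carrier M"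
  shows "module_iso R N M"
proof -
  obtain f where f: "f \<in> linear_maps R M N" "bij_betw f (carrier M) (carrier N)"
    using assms(1) by (auto simp: module_iso_def)
  define g where "g = inv_into (carrier M) f"
  have g: "bij_betw g (carrier N) (carrier M)"
    using f(2) unfolding g_def by (rule bij_betw_inv_into)
  have fg: "f (g y) = y" if "y \<in> carrier N" for y
    using that f(2) by (simp add: g_def bij_betw_inv_into_right)
  have gf: "g (f x) = x" if "x \<in> carrier M" for x
    using that f(2) by (simp add: g_def bij_betw_inv_into_left)
  have gc: "g y \<in> carrier M" if "y \<in> carrier N" for y
    using g that by (auto dest: bij_betwE)
  have "g \<in> linear_maps R N M"
  proof (rule linear_mapsI)
    fix x y assume "x \<in> carrier N" "y \<in> carrier N"
    then have "f (g x \<oplus>\<^bsub>M\<^esub> g y) = x \<oplus>\<^bsub>N\<^esub> y"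
      using f(1) gc fg by (simp add: linear_mapsD)
    then show "g (x \<oplus>\<^bsub>N\<^esub> y) = g x \<oplus>\<^bsub>M\<^esub> g y"
      using gf[of "g x \<oplus>\<^bsub>M\<^esub> g y"] assms(2) gc \<open>x \<in> carrier N\<close> \<open>y \<in> carrier N\<close> by simp
  next
    fix a x assume "a \<in> carrier R" "x \<in> carrier N"
    then have "f (a \<odot>\<^bsub>M\<^esub> g x) = a \<odot>\<^bsub>N\<^esub> x"
      using f(1) gc fg by (simp add: linear_mapsD)
    then show "g (a \<odot>\<^bsub>N\<^esub> x) = a \<odot>\<^bsub>M\<^esub> g x"
      using gf[of "a \<odot>\<^bsub>M\<^esub> g x"] assms(3) gc \<open>a \<in> carrier R\<close> \<open>x \<in> carrier N\<close> by simp
  qed (rule gc)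
  with g show ?thesis
    by (auto simp: module_iso_def)
qed


section \<open>Localization\<close>

text \<open>The operations of \<open>loc_module\<close> are unions over all representatives. Once
  the resulting class is known not to depend on the representatives, the union is one of equal sets
  over nonempty index sets, and it collapses to that class.\<close>

lemma UN_pair_const:
  assumes "p \<in> X" "q \<in> Y"
    and "\<And>a s b t. (a, s) \<in> X \<Longrightarrow> (b, t) \<in> Y \<Longrightarrow> F a s b t = C"
  shows "(\<Union>(a, s)\<in>X. \<Union>(b, t)\<in>Y. F a s b t) = C"
proof -
  have "(\<Union>y\<in>Y. case y of (b, t) \<Rightarrow> F a s b t) = (\<Union>y\<in>Y. C)" if "(a, s) \<in> X" for a s
    by (rule SUP_cong) (auto simp: assms(3)[OF that])
  then have "(\<Union>x\<in>X. case x of (a, s) \<Rightarrow> \<Union>(b, t)\<in>Y. F a s b t) = (\<Union>x\<in>X. \<Union>y\<in>Y. C)"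
    by (intro SUP_cong refl) (simp only: split_paired_all prod.case)
  also have "\<dots> = C"
    using assms(1,2) by auto
  finally show ?thesis .
qed

locale localization = module R M
  for R :: "('a, 'r) ring_scheme" (structure) and M :: "('a, 'm) module" (structure) +
  fixes S
  assumes S_subset: "S \<subseteq> carrier R"
    and S_one: "\<one> \<in> S"
    and S_mult: "s \<in> S \<Longrightarrow> t \<in> S \<Longrightarrow> s \<otimes> t \<in> S"
begin

lemma S_carrier [simp]: "s \<in> S \<Longrightarrow> s \<in> carrier R"
  using S_subset by blast

lemma equiv_frac_rel: "equiv (carrier M \<times> S) (frac_rel R S M)"
proof (rule equivI)
  show "refl_on (carrier M \<times> S) (frac_rel R S M)"
    using S_one by (auto simp: refl_on_def frac_rel_def)
  show "sym (frac_rel R S M)"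
    by (rule symI, clarsimp simp: frac_rel_def) metis
  show "trans (frac_rel R S M)"
  proof (rule transI, clarsimp simp: frac_rel_def)
    fix m n p s t r u v
    assume M: "m \<in> carrier M" "n \<in> carrier M" "p \<in> carrier M"
      and S: "s \<in> S" "t \<in> S" "r \<in> S" "u \<in> S" "v \<in> S"
      and u: "u \<odot>\<^bsub>M\<^esub> (t \<odot>\<^bsub>M\<^esub> m) = u \<odot>\<^bsub>M\<^esub> (s \<odot>\<^bsub>M\<^esub> n)"
      and v: "v \<odot>\<^bsub>M\<^esub> (r \<odot>\<^bsub>M\<^esub> n) = v \<odot>\<^bsub>M\<^esub> (t \<odot>\<^bsub>M\<^esub> p)"
    \<comment> \<open>The middle denominator \<open>t\<close> joins the two witnesses
      \<open>u\<close> and \<open>v\<close>, since both given relations mention \<open>n\<close>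
      only up to such factors.\<close>
    have "(u \<otimes> v \<otimes> t) \<odot>\<^bsub>M\<^esub> (r \<odot>\<^bsub>M\<^esub> m) = (v \<otimes> r) \<odot>\<^bsub>M\<^esub> (u \<odot>\<^bsub>M\<^esub> (t \<odot>\<^bsub>M\<^esub> m))"
      using M S by (simp add: smult_assoc1[symmetric] m_ac)
    also have "\<dots> = (u \<otimes> s) \<odot>\<^bsub>M\<^esub> (v \<odot>\<^bsub>M\<^esub> (r \<odot>\<^bsub>M\<^esub> n))"
      unfolding u using M S by (simp add: smult_assoc1[symmetric] m_ac)
    also have "\<dots> = (u \<otimes> v \<otimes> t) \<odot>\<^bsub>M\<^esub> (s \<odot>\<^bsub>M\<^esub> p)"
      unfolding v using M S by (simp add: smult_assoc1[symmetric] m_ac)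
    finally show "\<exists>w\<in>S. w \<odot>\<^bsub>M\<^esub> (r \<odot>\<^bsub>M\<^esub> m) = w \<odot>\<^bsub>M\<^esub> (s \<odot>\<^bsub>M\<^esub> p)"
      using S S_mult by blast
  qed
  show "frac_rel R S M \<subseteq> (carrier M \<times> S) \<times> (carrier M \<times> S)"
    by (auto simp: frac_rel_def)
qed

lemma fraction_eq_iff:
  assumes "m \<in> carrier M" "n \<in> carrier M" "s \<in> S" "t \<in> S"
  shows "fraction R S M m s = fraction R S M n t \<longleftrightarrow>
    (\<exists>u\<in>S. u \<odot>\<^bsub>M\<^esub> (t \<odot>\<^bsub>M\<^esub> m) = u \<odot>\<^bsub>M\<^esub> (s \<odot>\<^bsub>M\<^esub> n))"
  using eq_equiv_class_iff[OF equiv_frac_rel, of "(m, s)" "(n, t)"] assms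
  by (simp add: fraction_def frac_rel_def)

lemma mem_fractionD:
  assumes "(n, t) \<in> fraction R S M m s"
  shows "n \<in> carrier M" "t \<in> S"
    "\<exists>u\<in>S. u \<odot>\<^bsub>M\<^esub> (t \<odot>\<^bsub>M\<^esub> m) = u \<odot>\<^bsub>M\<^esub> (s \<odot>\<^bsub>M\<^esub> n)"
  using assms by (auto simp: fraction_def frac_rel_def)

lemma mem_fraction_self: "m \<in> carrier M \<Longrightarrow> s \<in> S \<Longrightarrow> (m, s) \<in> fraction R S M m s"
  using S_one by (auto simp: fraction_def frac_rel_def)

lemma loc_carrier: "carrier (loc_module R S M) = {fraction R S M m s | m s. m \<in> carrier M \<and> s \<in> S}"
  by (simp add: loc_module_def)

lemma fraction_closed: "m \<in> carrier M \<Longrightarrow> s \<in> S \<Longrightarrow> fraction R S M m s \<in> carrier (loc_module R S M)"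
  by (auto simp: loc_carrier)

text \<open>The localized ring has the carrier and the operations of the localized module
  \<open>self_module R\<close>, so every fact of this locale is available for ring fractions as
  well.\<close>

lemma localization_self: "localization R (self_module R) S"
  using self_module_module[OF R.is_cring] S_subset S_one S_mult
  by (simp add: localization_def localization_axioms_def)

text \<open>If \<open>u\<close> and \<open>v\<close> witness that the representatives of the two
  fractions are equivalent, then \<open>u \<otimes> v\<close> is a witness for the products. For
  \<open>M\<close> equal to \<open>self_module R\<close> this is also the multiplication rule of
  \<open>loc_ring R S\<close>.\<close>

lemma smult_fraction:
  assumes "a \<in> carrier R" "s \<in> S" "m \<in> carrier M" "t \<in> S"
  shows "fraction R S (self_module R) a s \<odot>\<^bsub>loc_module R S M\<^esub> fraction R S M m t =
    fraction R S M (a \<odot>\<^bsub>M\<^esub> m) (s \<otimes> t)"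
proof -
  interpret self: localization R "self_module R" S by (rule localization_self)
  have "fraction R S M (b \<odot>\<^bsub>M\<^esub> n) (s' \<otimes> t') = fraction R S M (a \<odot>\<^bsub>M\<^esub> m) (s \<otimes> t)"
    if X: "(b, s') \<in> fraction R S (self_module R) a s" and Y: "(n, t') \<in> fraction R S M m t"
    for b s' n t'
  proof -
    obtain u where u: "u \<in> S" "u \<otimes> (s' \<otimes> a) = u \<otimes> (s \<otimes> b)"
      using self.mem_fractionD[OF X] by auto
    obtain v where v: "v \<in> S" "v \<odot>\<^bsub>M\<^esub> (t' \<odot>\<^bsub>M\<^esub> m) = v \<odot>\<^bsub>M\<^esub> (t \<odot>\<^bsub>M\<^esub> n)"
      using mem_fractionD[OF Y] by auto
    have c: "b \<in> carrier R" "s' \<in> S" "n \<in> carrier M" "t' \<in> S"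
      using self.mem_fractionD[OF X] mem_fractionD[OF Y] by auto
    have "(u \<otimes> v) \<odot>\<^bsub>M\<^esub> ((s \<otimes> t) \<odot>\<^bsub>M\<^esub> (b \<odot>\<^bsub>M\<^esub> n)) =
        (u \<otimes> (s \<otimes> b)) \<odot>\<^bsub>M\<^esub> (v \<odot>\<^bsub>M\<^esub> (t \<odot>\<^bsub>M\<^esub> n))"
      using assms c u(1) v(1) by (simp add: smult_assoc1[symmetric] m_ac)
    also have "\<dots> = (u \<otimes> v) \<odot>\<^bsub>M\<^esub> ((s' \<otimes> t') \<odot>\<^bsub>M\<^esub> (a \<odot>\<^bsub>M\<^esub> m))"
      unfolding u(2)[symmetric] v(2)[symmetric]
      using assms c u(1) v(1) by (simp add: smult_assoc1[symmetric] m_ac)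
    finally show ?thesis
      using assms c u(1) v(1) S_mult by (subst fraction_eq_iff) auto
  qed
  moreover have "(a, s) \<in> fraction R S (self_module R) a s" "(m, t) \<in> fraction R S M m t"
    using assms by (simp_all add: self.mem_fraction_self mem_fraction_self)
  ultimately show ?thesis
    unfolding loc_module_def module.simps ring.simps by (intro UN_pair_const)
qed

lemma add_fraction:
  assumes "m \<in> carrier M" "s \<in> S" "n \<in> carrier M" "t \<in> S"
  shows "fraction R S M m s \<oplus>\<^bsub>loc_module R S M\<^esub> fraction R S M n t =
    fraction R S M (t \<odot>\<^bsub>M\<^esub> m \<oplus>\<^bsub>M\<^esub> s \<odot>\<^bsub>M\<^esub> n) (s \<otimes> t)"
proof -
  have "fraction R S M (t' \<odot>\<^bsub>M\<^esub> m' \<oplus>\<^bsub>M\<^esub> s' \<odot>\<^bsub>M\<^esub> n') (s' \<otimes> t') =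
      fraction R S M (t \<odot>\<^bsub>M\<^esub> m \<oplus>\<^bsub>M\<^esub> s \<odot>\<^bsub>M\<^esub> n) (s \<otimes> t)"
    if X: "(m', s') \<in> fraction R S M m s" and Y: "(n', t') \<in> fraction R S M n t"
    for m' s' n' t'
  proof -
    obtain u where u: "u \<in> S" "u \<odot>\<^bsub>M\<^esub> (s' \<odot>\<^bsub>M\<^esub> m) = u \<odot>\<^bsub>M\<^esub> (s \<odot>\<^bsub>M\<^esub> m')"
      using mem_fractionD[OF X] by auto
    obtain v where v: "v \<in> S" "v \<odot>\<^bsub>M\<^esub> (t' \<odot>\<^bsub>M\<^esub> n) = v \<odot>\<^bsub>M\<^esub> (t \<odot>\<^bsub>M\<^esub> n')"
      using mem_fractionD[OF Y] by auto
    have c: "m' \<in> carrier M" "s' \<in> S" "n' \<in> carrier M" "t' \<in> S"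
      using mem_fractionD[OF X] mem_fractionD[OF Y] by auto
    have "(u \<otimes> v) \<odot>\<^bsub>M\<^esub> ((s \<otimes> t) \<odot>\<^bsub>M\<^esub> (t' \<odot>\<^bsub>M\<^esub> m' \<oplus>\<^bsub>M\<^esub> s' \<odot>\<^bsub>M\<^esub> n')) =
        (v \<otimes> t \<otimes> t') \<odot>\<^bsub>M\<^esub> (u \<odot>\<^bsub>M\<^esub> (s \<odot>\<^bsub>M\<^esub> m')) \<oplus>\<^bsub>M\<^esub>
        (u \<otimes> s \<otimes> s') \<odot>\<^bsub>M\<^esub> (v \<odot>\<^bsub>M\<^esub> (t \<odot>\<^bsub>M\<^esub> n'))"
      using assms c u(1) v(1) by (simp add: smult_r_distr smult_assoc1[symmetric] m_ac)
    also have "\<dots> = (u \<otimes> v) \<odot>\<^bsub>M\<^esub> ((s' \<otimes> t') \<odot>\<^bsub>M\<^esub> (t \<odot>\<^bsub>M\<^esub> m \<oplus>\<^bsub>M\<^esub> s \<odot>\<^bsub>M\<^esub> n))"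
      unfolding u(2)[symmetric] v(2)[symmetric]
      using assms c u(1) v(1) by (simp add: smult_r_distr smult_assoc1[symmetric] m_ac)
    finally show ?thesis
      using assms c u(1) v(1) S_mult by (subst fraction_eq_iff) auto
  qed
  moreover have "(m, s) \<in> fraction R S M m s" "(n, t) \<in> fraction R S M n t"
    using assms by (simp_all add: mem_fraction_self)
  ultimately show ?thesis
    unfolding loc_module_def module.simps ring.simps by (intro UN_pair_const)
qed

end

section \<open>Freeness of rank one after localization, in terms of elements\<close>

lemma free_module_simps [simp]:
  "zero (free_module R I) = (\<lambda>_. \<zero>\<^bsub>R\<^esub>)"
  "add (free_module R I) = (\<lambda>v w i. v i \<oplus>\<^bsub>R\<^esub> w i)"
  "smult (free_module R I) = (\<lambda>a v i. a \<otimes>\<^bsub>R\<^esub> v i)"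
  by (simp_all add: free_module_def)

lemma free_module_carrier_finite:
  assumes "finite I"
  shows "carrier (free_module R I) =
    {v. (\<forall>i\<in>I. v i \<in> carrier R) \<and> (\<forall>i. i \<notin> I \<longrightarrow> v i = \<zero>\<^bsub>R\<^esub>)}"
proof -
  have "finite {i. v i \<noteq> \<zero>\<^bsub>R\<^esub>}" if "\<forall>i. i \<notin> I \<longrightarrow> v i = \<zero>\<^bsub>R\<^esub>" for v
    using that by (intro finite_subset[OF _ assms]) auto
  then show ?thesis
    by (auto simp: free_module_def)
qed

lemma (in abelian_group) diff_zero_imp_eq:
  assumes "x \<in> carrier G" "y \<in> carrier G" "x \<ominus> y = \<zero>"
  shows "x = y"
  using minus_equality[of x "\<ominus> y"] assms by (simp add: a_minus_def)

lemma loc_ring_simps [simp]: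
  "carrier (loc_ring R S) = carrier (loc_module R S (self_module R))"
  "mult (loc_ring R S) = smult (loc_module R S (self_module R))"
  "add (loc_ring R S) = add (loc_module R S (self_module R))"
  "zero (loc_ring R S) = fraction R S (self_module R) \<zero>\<^bsub>R\<^esub> \<one>\<^bsub>R\<^esub>"
  "one (loc_ring R S) = fraction R S (self_module R) \<one>\<^bsub>R\<^esub> \<one>\<^bsub>R\<^esub>"
  by (simp_all add: loc_ring_def Let_def loc_module_def)

context localization
begin

text \<open>The generator of the localized module may be taken with denominator \<open>1\<close>, which turns freeness
  of rank \<open>1\<close> into a statement about \<open>M\<close> itself.\<close>

lemma loc_module_free_rank_one_iff:
  "module_iso (loc_ring R S) (loc_module R S M) (free_module (loc_ring R S) {..<1::nat}) \<longleftrightarrow>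
    (\<exists>g\<in>carrier M.
      (\<forall>m\<in>carrier M. \<exists>t\<in>S. \<exists>r\<in>carrier R. t \<odot>\<^bsub>M\<^esub> m = r \<odot>\<^bsub>M\<^esub> g) \<and>
      (\<forall>r\<in>carrier R. r \<odot>\<^bsub>M\<^esub> g = \<zero>\<^bsub>M\<^esub> \<longrightarrow> (\<exists>t\<in>S. t \<otimes> r = \<zero>)))"
  (is "?iso \<longleftrightarrow> (\<exists>g\<in>carrier M. ?gen g \<and> ?tor g)")
proof -
  interpret self: localization R "self_module R" S by (rule localization_self)
  let ?L = "loc_ring R S" and ?N = "loc_module R S M"
  let ?F = "free_module ?L {..<1::nat}"
  have F1: "carrier ?F = {v. v 0 \<in> carrier ?L \<and> (\<forall>i>0. v i = \<zero>\<^bsub>?L\<^esub>)}"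
    by (auto simp: free_module_carrier_finite)
  \<comment> \<open>The simplifier rewrites \<open>1\<close> to \<open>Suc 0\<close>, so the
    description of the carrier is kept in both forms.\<close>
  note F = F1 F1[unfolded One_nat_def]
  note fr [simp] = self.smult_fraction[simplified] self.add_fraction[simplified]
    smult_fraction add_fraction S_mult S_one
    self.fraction_closed[simplified] fraction_closed
  have zero_L: "\<zero>\<^bsub>?L\<^esub> \<in> carrier ?L" and one_L: "\<one>\<^bsub>?L\<^esub> \<in> carrier ?L"
    by simp_all
  show ?thesis
  proof
    assume ?iso
    then obtain f where f: "f \<in> linear_maps ?L ?N ?F" "bij_betw f (carrier ?N) (carrier ?F)"
      by (auto simp: module_iso_def)
    \<comment> \<open>The basis vector of the free module of rank one. Its preimage is a fraction
      g/s, and the numerator \<open>g\<close> is the element sought: s is a unit in the localized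
      ring.\<close>
    define e :: "nat \<Rightarrow> ('a \<times> 'a) set" where "e i = (if i < 1 then \<one>\<^bsub>?L\<^esub> else \<zero>\<^bsub>?L\<^esub>)" for i
    have "e \<in> carrier ?F"
      using one_L by (simp add: F e_def)
    then have "e \<in> f ` carrier ?N"
      using bij_betw_imp_surj_on[OF f(2)] by simp
    then obtain X where X: "X \<in> carrier ?N" "f X = e"
      by (auto elim: imageE)
    then obtain g s where g: "X = fraction R S M g s" "g \<in> carrier M" "s \<in> S"
      by (auto simp: loc_carrier)
    \<comment> \<open>The image of m/1 is a multiple r/t of \<open>e\<close>, so m/1 = (r g)/(t s)
      by injectivity. Clearing denominators gives the required relation in \<open>M\<close>.\<close>
    have "?gen g"
    proof
      fix m assume m: "m \<in> carrier M"
      then have Y: "fraction R S M m \<one> \<in> carrier ?N"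
        by simp
      then have fY: "f (fraction R S M m \<one>) \<in> carrier ?F"
        using f(1) by (simp add: linear_mapsD)
      then obtain r t where c: "f (fraction R S M m \<one>) 0 = fraction R S (self_module R) r t"
          "r \<in> carrier R" "t \<in> S"
        by (auto simp: F self.loc_carrier)
      let ?c = "fraction R S (self_module R) r t"
      have cL: "?c \<in> carrier ?L"
        using c by simp
      have cX: "?c \<odot>\<^bsub>?N\<^esub> X \<in> carrier ?N"
        using c g by simp
      have "f (?c \<odot>\<^bsub>?N\<^esub> X) = ?c \<odot>\<^bsub>?F\<^esub> e"
        using linear_mapsD(3)[OF f(1) cL X(1)] X(2) by simp
      also have "\<dots> = f (fraction R S M m \<one>)"
      proof
        fix i show "(?c \<odot>\<^bsub>?F\<^esub> e) i = f (fraction R S M m \<one>) i"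
        proof (cases "i = 0")
          case True
          then show ?thesis using c by (simp add: e_def)
        next
          case False
          then have "f (fraction R S M m \<one>) i = \<zero>\<^bsub>?L\<^esub>"
            using fY by (simp add: F)
          \<comment> \<open>The default value of a vector is the fraction 0/1, while the multiple of
            \<open>e\<close> has the entry 0/t there.\<close>
          moreover have "fraction R S (self_module R) \<zero> t = fraction R S (self_module R) \<zero> \<one>"
            using c by (subst self.fraction_eq_iff) (auto intro: bexI[OF _ S_one])
          ultimately show ?thesis
            using False c by (simp add: e_def)
        qed
      qed
      finally have "?c \<odot>\<^bsub>?N\<^esub> X = fraction R S M m \<one>"
        using f(2) cX Y by (auto simp: bij_betw_def inj_on_def)
      then have "\<exists>u\<in>S. u \<odot>\<^bsub>M\<^esub> (\<one> \<odot>\<^bsub>M\<^esub> (r \<odot>\<^bsub>M\<^esub> g)) = u \<odot>\<^bsub>M\<^esub> ((t \<otimes> s) \<odot>\<^bsub>M\<^esub> m)"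
        using c g m by (simp add: fraction_eq_iff)
      then obtain u where u: "u \<in> S"
          "u \<odot>\<^bsub>M\<^esub> (\<one> \<odot>\<^bsub>M\<^esub> (r \<odot>\<^bsub>M\<^esub> g)) = u \<odot>\<^bsub>M\<^esub> ((t \<otimes> s) \<odot>\<^bsub>M\<^esub> m)"
        by blast
      then have "(u \<otimes> (t \<otimes> s)) \<odot>\<^bsub>M\<^esub> m = (u \<otimes> r) \<odot>\<^bsub>M\<^esub> g"
        using c g m by (simp add: smult_assoc1)
      with u(1) c g show "\<exists>t\<in>S. \<exists>r\<in>carrier R. t \<odot>\<^bsub>M\<^esub> m = r \<odot>\<^bsub>M\<^esub> g"
        by (metis S_mult S_carrier m_closed)
    qed
    \<comment> \<open>If r g = 0, then r/1 and 0 have the same product with the preimage of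
      \<open>e\<close>, hence with \<open>e\<close> itself; coordinate 0 then says r/1 =
      0/1.\<close>
    moreover have "?tor g"
    proof (intro ballI impI)
      fix r assume r: "r \<in> carrier R" "r \<odot>\<^bsub>M\<^esub> g = \<zero>\<^bsub>M\<^esub>"
      let ?r = "fraction R S (self_module R) r \<one>"
      have rL: "?r \<in> carrier ?L"
        using r by simp
      have "?r \<odot>\<^bsub>?N\<^esub> X = \<zero>\<^bsub>?L\<^esub> \<odot>\<^bsub>?N\<^esub> X"
        using r g by simp
      then have "?r \<odot>\<^bsub>?F\<^esub> e = \<zero>\<^bsub>?L\<^esub> \<odot>\<^bsub>?F\<^esub> e"
        using linear_mapsD(3)[OF f(1) rL X(1)] linear_mapsD(3)[OF f(1) zero_L X(1)] X(2) by simp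
      from fun_cong[OF this, of 0]
      have "fraction R S (self_module R) r \<one> = fraction R S (self_module R) \<zero> \<one>"
        using r by (simp add: e_def)
      then show "\<exists>t\<in>S. t \<otimes> r = \<zero>"
        using r by (subst (asm) self.fraction_eq_iff) auto
    qed
    ultimately show "\<exists>g\<in>carrier M. ?gen g \<and> ?tor g"
      using g by blast
  next
    assume "\<exists>g\<in>carrier M. ?gen g \<and> ?tor g"
    then obtain g where g: "g \<in> carrier M" "?gen g" "?tor g" by blast
    let ?G = "fraction R S M g \<one>"
    \<comment> \<open>The map from the free module into the localization has an explicit formula, so
      it is the one shown to be bijective; the required isomorphism is its inverse.\<close>
    define h where "h v = v 0 \<odot>\<^bsub>?N\<^esub> ?G" for v :: "nat \<Rightarrow> ('a \<times> 'a) set"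
    have F_eqI: "v = w" if "v \<in> carrier ?F" "w \<in> carrier ?F" "v 0 = w 0" for v w
    proof
      fix i show "v i = w i"
        using that by (cases "i = 0") (auto simp: F)
    qed
    have closed: "v 0 \<in> carrier ?L" if "v \<in> carrier ?F" for v
      using that by (simp add: F)
    have zmul: "c \<otimes>\<^bsub>?L\<^esub> \<zero>\<^bsub>?L\<^esub> = \<zero>\<^bsub>?L\<^esub>" if c: "c \<in> carrier ?L" for c
    proof -
      obtain a s where "c = fraction R S (self_module R) a s" "a \<in> carrier R" "s \<in> S"
        using c by (auto simp: self.loc_carrier)
      then show ?thesis
        by (simp add: self.fraction_eq_iff) (auto intro: bexI[OF _ S_one])
    qed
    have addL: "c \<oplus>\<^bsub>?L\<^esub> d \<in> carrier ?L" and mulL: "c \<otimes>\<^bsub>?L\<^esub> d \<in> carrier ?L"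
      if "c \<in> carrier ?L" "d \<in> carrier ?L" for c d
      using that by (fastforce simp: self.loc_carrier)+
    have lin: "h \<in> linear_maps ?L ?F ?N"
    proof (rule linear_mapsI)
      fix v assume "v \<in> carrier ?F"
      from closed[OF this] show "h v \<in> carrier ?N"
        using g(1) by (fastforce simp: h_def self.loc_carrier loc_carrier)
    next
      fix v w assume "v \<in> carrier ?F" "w \<in> carrier ?F"
      then obtain a s b t where "v 0 = fraction R S (self_module R) a s" "a \<in> carrier R" "s \<in> S"
        and "w 0 = fraction R S (self_module R) b t" "b \<in> carrier R" "t \<in> S"
        using closed[of v] closed[of w] by (auto simp: self.loc_carrier)
      then show "h (v \<oplus>\<^bsub>?F\<^esub> w) = h v \<oplus>\<^bsub>?N\<^esub> h w"
        using g(1) by (simp add: h_def smult_l_distr smult_assoc1)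
    next
      fix c v assume "c \<in> carrier ?L" "v \<in> carrier ?F"
      then obtain a s b t where "c = fraction R S (self_module R) a s" "a \<in> carrier R" "s \<in> S"
        and "v 0 = fraction R S (self_module R) b t" "b \<in> carrier R" "t \<in> S"
        using closed[of v] by (auto simp: self.loc_carrier)
      then show "h (c \<odot>\<^bsub>?F\<^esub> v) = c \<odot>\<^bsub>?N\<^esub> h v"
        using g(1) by (simp add: h_def smult_assoc1)
    qed
    have "bij_betw h (carrier ?F) (carrier ?N)"
    proof (rule bij_betwI')
      fix v w assume vw: "v \<in> carrier ?F" "w \<in> carrier ?F"
      then obtain a s b t where v: "v 0 = fraction R S (self_module R) a s" "a \<in> carrier R" "s \<in> S"
        and w: "w 0 = fraction R S (self_module R) b t" "b \<in> carrier R" "t \<in> S"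
        using closed[of v] closed[of w] by (auto simp: self.loc_carrier)
      have "v 0 = w 0" if "h v = h w"
      proof -
        from that obtain u where u: "u \<in> S"
          "u \<odot>\<^bsub>M\<^esub> (t \<odot>\<^bsub>M\<^esub> (a \<odot>\<^bsub>M\<^esub> g)) = u \<odot>\<^bsub>M\<^esub> (s \<odot>\<^bsub>M\<^esub> (b \<odot>\<^bsub>M\<^esub> g))"
          using v w g(1) by (auto simp: h_def fraction_eq_iff)
        \<comment> \<open>Equal images mean that this scalar kills \<open>g\<close>. The torsion
          condition supplies \<open>t'\<close>, and \<open>t' \<otimes> u\<close> is the witness
          that the two coordinates are the same fraction.\<close>
        have "(u \<otimes> (t \<otimes> a \<ominus> s \<otimes> b)) \<odot>\<^bsub>M\<^esub> g = \<zero>\<^bsub>M\<^esub>"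
          using u v w g(1)
          by (simp add: smult_assoc1 smult_r_distr smult_l_distr a_minus_def smult_l_minus
              smult_r_minus M.r_neg)
        then obtain t' where t': "t' \<in> S" "t' \<otimes> (u \<otimes> (t \<otimes> a \<ominus> s \<otimes> b)) = \<zero>"
          using g(3) u v w by (metis S_carrier R.m_closed R.minus_closed)
        have "(t' \<otimes> u) \<otimes> (t \<otimes> a) \<ominus> (t' \<otimes> u) \<otimes> (s \<otimes> b) = t' \<otimes> (u \<otimes> (t \<otimes> a \<ominus> s \<otimes> b))"
          using t'(1) u(1) v w by (simp add: a_minus_def r_distr r_minus m_assoc)
        then have "(t' \<otimes> u) \<otimes> (t \<otimes> a) = (t' \<otimes> u) \<otimes> (s \<otimes> b)"
          using t' u(1) v w by - (rule R.diff_zero_imp_eq, simp_all)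
        then show ?thesis
          using t'(1) u(1) v w by (auto simp: self.fraction_eq_iff intro!: bexI[of _ "t' \<otimes> u"])
      qed
      then show "(h v = h w) = (v = w)"
        using F_eqI[OF vw] by auto
    next
      fix v assume "v \<in> carrier ?F"
      then show "h v \<in> carrier ?N" using lin by (rule linear_mapsD(1)[rotated])
    next
      fix Y assume "Y \<in> carrier ?N"
      then obtain m s where Y: "Y = fraction R S M m s" "m \<in> carrier M" "s \<in> S"
        by (auto simp: loc_carrier)
      obtain t r where tr: "t \<in> S" "r \<in> carrier R" "t \<odot>\<^bsub>M\<^esub> m = r \<odot>\<^bsub>M\<^esub> g"
        using g(2) Y(2) by blast
      \<comment> \<open>From t m = r g one gets m/s = (r g)/(t s), so this coordinate is a preimage
        of m/s.\<close>
      let ?c = "fraction R S (self_module R) r (t \<otimes> s)"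
      define v where "v i = (if i = 0 then ?c else \<zero>\<^bsub>?L\<^esub>)" for i :: nat
      have "v \<in> carrier ?F"
        using tr Y by (auto simp: F v_def)
      moreover have "s \<odot>\<^bsub>M\<^esub> (r \<odot>\<^bsub>M\<^esub> g) = (t \<otimes> s) \<odot>\<^bsub>M\<^esub> m"
        unfolding tr(3)[symmetric] using tr(1,2) Y by (simp add: smult_assoc1[symmetric] m_ac)
      then have "Y = h v"
        using tr Y g(1) by (auto simp: h_def v_def fraction_eq_iff intro!: bexI[OF _ S_one])
      ultimately show "\<exists>v\<in>carrier ?F. Y = h v" by blast
    qed
    with lin have "module_iso ?L ?F ?N"
      by (auto simp: module_iso_def)
    then show ?iso
      by (rule module_iso_sym) (auto simp: F addL[simplified] mulL[simplified] zmul[simplified])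
  qed
qed

end

section \<open>Matrices of size two\<close>

definition vec2 :: "('a, 'r) ring_scheme \<Rightarrow> 'a \<Rightarrow> 'a \<Rightarrow> nat \<Rightarrow> 'a" where
  "vec2 R p q = (\<lambda>i. if i = 0 then p else if i = 1 then q else \<zero>\<^bsub>R\<^esub>)"

lemma vec2_simps [simp]:
  "vec2 R p q 0 = p" "vec2 R p q (Suc 0) = q" "2 \<le> i \<Longrightarrow> vec2 R p q i = \<zero>\<^bsub>R\<^esub>"
  by (auto simp: vec2_def)

lemma free2_carrier:
  "carrier (free_module R {..<2::nat}) =
    {v. v 0 \<in> carrier R \<and> v 1 \<in> carrier R \<and> (\<forall>i\<ge>2. v i = \<zero>\<^bsub>R\<^esub>)}"
  by (auto simp: free_module_carrier_finite less_2_cases_iff)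

lemma all_less_2: "(\<forall>i<2. P i) \<longleftrightarrow> P 0 \<and> P (1::nat)"
  by (auto simp: less_2_cases_iff)

lemma vec2_carrier [simp]:
  "vec2 R p q \<in> carrier (free_module R {..<2}) \<longleftrightarrow> p \<in> carrier R \<and> q \<in> carrier R"
  by (auto simp: free2_carrier)

lemma free2_vec2:
  "v \<in> carrier (free_module R {..<2}) \<Longrightarrow> v = vec2 R (v 0) (v 1)"
  by (auto simp: free2_carrier vec2_def)

lemma vec2_eq_iff [simp]: "vec2 R p q = vec2 R p' q' \<longleftrightarrow> p = p' \<and> q = q'"
  by (metis vec2_simps(1,2))

lemma mat_module_carrier:
  "carrier (mat_module R m n) =
    {A. (\<forall>i<m. \<forall>j<n. A (i, j) \<in> carrier R) \<and> (\<forall>i j. \<not> (i < m \<and> j < n) \<longrightarrow> A (i, j) = \<zero>\<^bsub>R\<^esub>)}"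
  by (auto simp: mat_module_def free_module_carrier_finite)

section \<open>Coordinate forms of unimodularity, factorization and extendability\<close>

context cring
begin

lemma free2_closed:
  assumes "v \<in> carrier (free_module R {..<2::nat})"
  shows "w \<in> carrier (free_module R {..<2}) \<Longrightarrow> (\<lambda>i. v i \<oplus> w i) \<in> carrier (free_module R {..<2})"
    and "a \<in> carrier R \<Longrightarrow> (\<lambda>i. a \<otimes> v i) \<in> carrier (free_module R {..<2})"
  using assms by (auto simp: free2_carrier)

lemma vec2_add [simp]:
  "(\<lambda>i. vec2 R p q i \<oplus> vec2 R p' q' i) = vec2 R (p \<oplus> p') (q \<oplus> q')"
  by (auto simp: vec2_def)

lemma vec2_smult [simp]:
  "a \<in> carrier R \<Longrightarrow> (\<lambda>i. a \<otimes> vec2 R p q i) = vec2 R (a \<otimes> p) (a \<otimes> q)"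
  by (auto simp: vec2_def)

lemma vec2_zero: "(\<lambda>_. \<zero>) = vec2 R \<zero> \<zero>"
  by (auto simp: vec2_def)

lemma finsum_lessThan_2: "f 0 \<in> carrier R \<Longrightarrow> f 1 \<in> carrier R \<Longrightarrow> finsum R f {..<2} = f 0 \<oplus> f (1::nat)"
proof -
  assume "f 0 \<in> carrier R" "f 1 \<in> carrier R"
  moreover have "{..<2} = {0, 1::nat}" by auto
  ultimately show ?thesis by simp
qed

lemma L_map_vec2:
  assumes "A \<in> carrier (mat_module R 2 2)" "x \<in> carrier R" "y \<in> carrier R"
  shows "L_map R A (vec2 R x y) =
    vec2 R (A (0, 0) \<otimes> x \<oplus> A (0, 1) \<otimes> y) (A (1, 0) \<otimes> x \<oplus> A (1, 1) \<otimes> y)"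
proof
  fix i :: nat
  have "A (i, j) \<in> carrier R" for j
    using assms(1) by (cases "i < 2 \<and> j < 2") (auto simp: mat_module_carrier)
  then have "L_map R A (vec2 R x y) i = A (i, 0) \<otimes> x \<oplus> A (i, 1) \<otimes> y"
    using assms(2,3) by (simp add: L_map_def finsum_lessThan_2)
  moreover have "i = 0 \<or> i = 1 \<or> 2 \<le> i" by auto
  ultimately show "L_map R A (vec2 R x y) i = vec2 R (A (0, 0) \<otimes> x \<oplus> A (0, 1) \<otimes> y)
      (A (1, 0) \<otimes> x \<oplus> A (1, 1) \<otimes> y) i"
    using assms by (auto simp: mat_module_carrier)
qed

lemma mat_det_2:
  assumes "\<And>i j. i < 2 \<Longrightarrow> j < 2 \<Longrightarrow> A (i, j) \<in> carrier R"
  shows "mat_det R 2 A = A (0, 0) \<otimes> A (1, 1) \<ominus> A (0, 1) \<otimes> A (1, 0)"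
proof -
  have "A (0, 0) \<in> carrier R" "A (0, Suc 0) \<in> carrier R" "A (Suc 0, 0) \<in> carrier R"
      "A (Suc 0, Suc 0) \<in> carrier R"
    using assms by auto
  moreover have "{..Suc 0} = {0, Suc 0}" by auto
  ultimately show ?thesis
    by (simp add: numeral_2_eq_2 a_minus_def l_minus a_comm)
qed

lemma mat_det_3:
  assumes "\<And>i j. i < 3 \<Longrightarrow> j < 3 \<Longrightarrow> A (i, j) \<in> carrier R"
  shows "mat_det R 3 A = A (0, 0) \<otimes> (A (1, 1) \<otimes> A (2, 2) \<ominus> A (1, 2) \<otimes> A (2, 1)) \<ominus>
    A (0, 1) \<otimes> (A (1, 0) \<otimes> A (2, 2) \<ominus> A (1, 2) \<otimes> A (2, 0)) \<oplus>
    A (0, 2) \<otimes> (A (1, 0) \<otimes> A (2, 1) \<ominus> A (1, 1) \<otimes> A (2, 0))"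
proof -
  have c: "A (i, j) \<in> carrier R" if "i < Suc (Suc (Suc 0))" "j < Suc (Suc (Suc 0))" for i j
    using assms that by (simp add: numeral_3_eq_3)
  have "{..Suc (Suc 0)} = {0, Suc 0, Suc (Suc 0)}" "{..Suc 0} = {0, Suc 0}" by auto
  then show ?thesis
    using c by (simp add: numeral_3_eq_3 numeral_2_eq_2 a_minus_def l_minus r_minus a_ac)
qed

text \<open>A linear functional on matrices is determined by its values on the four matrix units,
  and these values are the coefficients \<open>x\<close>, \<open>y\<close>, \<open>z\<close>,
  \<open>w\<close>. Conversely, any four coefficients define a functional.\<close>

lemma Um_mat_iff:
  assumes "A \<in> carrier (mat_module R 2 2)"
  shows "A \<in> Um R (mat_module R 2 2) \<longleftrightarrow>
    (\<exists>x\<in>carrier R. \<exists>y\<in>carrier R. \<exists>z\<in>carrier R. \<exists>w\<in>carrier R.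
      A (0, 0) \<otimes> x \<oplus> A (0, 1) \<otimes> y \<oplus> (A (1, 0) \<otimes> z \<oplus> A (1, 1) \<otimes> w) = \<one>)"
    (is "_ \<longleftrightarrow> ?R")
proof
  have add: "add (mat_module R 2 2) = (\<lambda>v w i. v i \<oplus> w i)"
    and smult: "smult (mat_module R 2 2) = (\<lambda>a v i. a \<otimes> v i)"
    by (simp_all add: mat_module_def)
  {
    assume "A \<in> Um R (mat_module R 2 2)"
    then obtain L where L: "L \<in> linear_maps R (mat_module R 2 2) (self_module R)" "L A = \<one>"
      by (auto simp: Um_def)
    define E where "E p = (\<lambda>q. if p = q then \<one> else \<zero>)" for p :: "nat \<times> nat"
    have E: "E p \<in> carrier (mat_module R 2 2)" if "p \<in> {..<2} \<times> {..<2}" for p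
      using that by (auto simp: mat_module_carrier E_def)
    have c: "A (0, 0) \<in> carrier R" "A (0, Suc 0) \<in> carrier R" "A (Suc 0, 0) \<in> carrier R"
        "A (Suc 0, Suc 0) \<in> carrier R"
      using assms by (auto simp: mat_module_carrier)
    \<comment> \<open>The summand of \<open>A\<close> at position \<open>p\<close>: its entry times
      the matrix unit \<open>E p\<close>. The four summands add up to \<open>A\<close>.\<close>
    define T where "T p = (\<lambda>q. A p \<otimes> E p q)" for p
    have T: "T p \<in> carrier (mat_module R 2 2)" "L (T p) = A p \<otimes> L (E p)"
      if "p \<in> {..<2} \<times> {..<2}" for p
    proof -
      have Ap: "A p \<in> carrier R"
        using that assms by (auto simp: mat_module_carrier)
      then show "T p \<in> carrier (mat_module R 2 2)"
        using E[OF that] by (auto simp: T_def mat_module_carrier)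
      show "L (T p) = A p \<otimes> L (E p)"
        using linear_mapsD(3)[OF L(1) Ap E[OF that]] by (simp add: T_def smult)
    qed
    have sum_closed: "(\<lambda>q. B q \<oplus> C q) \<in> carrier (mat_module R 2 2)"
      "L (\<lambda>q. B q \<oplus> C q) = L B \<oplus> L C"
      if "B \<in> carrier (mat_module R 2 2)" "C \<in> carrier (mat_module R 2 2)" for B C
      using that linear_mapsD(2)[OF L(1) that] by (auto simp: mat_module_carrier add)
    have "A q = T (0, 0) q \<oplus> T (0, 1) q \<oplus> (T (1, 0) q \<oplus> T (1, 1) q)" for q
    proof (cases q)
      case (Pair i j)
      show ?thesis
      proof (cases "i < 2 \<and> j < 2")
        case True
        then show ?thesis
          using c by (auto simp: Pair T_def E_def less_2_cases_iff)
      next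
        case False
        then have "A q = \<zero>" using assms by (auto simp: Pair mat_module_carrier)
        then show ?thesis
          using False c by (auto simp: Pair T_def E_def)
      qed
    qed
    then have "A = (\<lambda>q. T (0, 0) q \<oplus> T (0, 1) q \<oplus> (T (1, 0) q \<oplus> T (1, 1) q))"
      by blast
    then have "L A = L (T (0, 0)) \<oplus> L (T (0, 1)) \<oplus> (L (T (1, 0)) \<oplus> L (T (1, 1)))"
      using T(1) sum_closed by simp
    then have "\<one> = A (0, 0) \<otimes> L (E (0, 0)) \<oplus> A (0, 1) \<otimes> L (E (0, 1)) \<oplus>
        (A (1, 0) \<otimes> L (E (1, 0)) \<oplus> A (1, 1) \<otimes> L (E (1, 1)))"
      using L(2) by (simp add: T(2))
    moreover have "L (E p) \<in> carrier R" if "p \<in> {..<2} \<times> {..<2}" for p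
      using linear_mapsD(1)[OF L(1) E[OF that]] by simp
    ultimately show ?R
      by - (rule bexI[of _ "L (E (0, 0))"], rule bexI[of _ "L (E (0, 1))"], rule bexI[of _ "L (E (1, 0))"], rule bexI[of _ "L (E (1, 1))"], auto)
  next
    assume ?R
    then obtain x y z w where xyzw: "x \<in> carrier R" "y \<in> carrier R" "z \<in> carrier R" "w \<in> carrier R"
      "A (0, 0) \<otimes> x \<oplus> A (0, 1) \<otimes> y \<oplus> (A (1, 0) \<otimes> z \<oplus> A (1, 1) \<otimes> w) = \<one>"
      by blast
    define L where "L B = B (0, 0) \<otimes> x \<oplus> B (0, 1) \<otimes> y \<oplus> (B (1, 0) \<otimes> z \<oplus> B (1, 1) \<otimes> w)"
      for B :: "nat \<times> nat \<Rightarrow> 'a"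
    have "L \<in> linear_maps R (mat_module R 2 2) (self_module R)"
      using xyzw(1-4)
      by (intro linear_mapsI)
        (simp_all add: mat_module_carrier add smult L_def all_less_2 l_distr r_distr a_ac m_assoc)
    then show "A \<in> Um R (mat_module R 2 2)"
      using assms xyzw(5) by (auto simp: Um_def L_def intro!: bexI[of _ L])
  }
qed

lemma non_full_iff:
  assumes "A \<in> carrier (mat_module R 2 2)"
  shows "non_full R A \<longleftrightarrow> (\<exists>p\<in>carrier R. \<exists>q\<in>carrier R. \<exists>r\<in>carrier R. \<exists>s\<in>carrier R.
    A (0, 0) = p \<otimes> r \<and> A (0, 1) = p \<otimes> s \<and> A (1, 0) = q \<otimes> r \<and> A (1, 1) = q \<otimes> s)" (is "_ \<longleftrightarrow> ?R")
proof
  have mult1: "mat_mult R 1 B C (i, j) = B (i, 0) \<otimes> C (0, j)"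
    if "B (i, 0) \<in> carrier R" "C (0, j) \<in> carrier R" for B C i j
    using that by (simp add: mat_mult_def lessThan_Suc)
  {
    assume "non_full R A"
    then obtain B C where "B \<in> carrier (mat_module R 2 1)" "C \<in> carrier (mat_module R 1 2)"
      "A = mat_mult R 1 B C"
      by (auto simp: non_full_def)
    then show ?R
      by - (rule bexI[of _ "B (0, 0)"], rule bexI[of _ "B (1, 0)"], rule bexI[of _ "C (0, 0)"], rule bexI[of _ "C (0, 1)"], auto simp: mat_module_carrier mult1 simp del: One_nat_def)
  next
    assume ?R
    then obtain p q r s where pqrs: "p \<in> carrier R" "q \<in> carrier R" "r \<in> carrier R" "s \<in> carrier R"
      "A (0, 0) = p \<otimes> r" "A (0, 1) = p \<otimes> s" "A (1, 0) = q \<otimes> r" "A (1, 1) = q \<otimes> s"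
      by blast
    define B where "B = (\<lambda>(i, j::nat). if j = 0 then vec2 R p q i else \<zero>)"
    define C where "C = (\<lambda>(i::nat, j). if i = 0 then vec2 R r s j else \<zero>)"
    have c: "vec2 R u v i \<in> carrier R" if "u \<in> carrier R" "v \<in> carrier R" for u v i
      using that by (simp add: vec2_def)
    have BC: "B \<in> carrier (mat_module R 2 1)" "C \<in> carrier (mat_module R 1 2)"
      using pqrs c by (auto simp: B_def C_def mat_module_carrier)
    have "A (i, j) = mat_mult R 1 B C (i, j)" for i j
    proof -
      have "mat_mult R 1 B C (i, j) = vec2 R p q i \<otimes> vec2 R r s j"
        using pqrs c by (subst mult1) (auto simp: B_def C_def)
      also have "\<dots> = A (i, j)"
      proof (cases "i < 2 \<and> j < 2")
        case True
        then show ?thesis using pqrs by (auto simp: less_2_cases_iff)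
      next
        case False
        \<comment> \<open>Equality of matrices is equality of functions, so positions outside the
          index range count too. There \<open>A\<close> is zero, and one of the two factors takes
          the default value of \<open>vec2\<close>.\<close>
        then have "A (i, j) = \<zero>" using assms by (auto simp: mat_module_carrier)
        moreover have "vec2 R p q i = \<zero> \<or> vec2 R r s j = \<zero>" using False by auto
        ultimately show ?thesis using pqrs c by auto
      qed
      finally show ?thesis by simp
    qed
    then have "A = mat_mult R 1 B C" by auto
    with BC show "non_full R A" by (auto simp: non_full_def)
  }
qed

text \<open>The displayed expression is the determinant of the extension with last column
  \<open>(e, f, i)\<close> and last row \<open>(g, h, i)\<close>, expanded along the first
  row.\<close>

lemma extendable_iff:
  assumes "A \<in> carrier (mat_module R 2 2)"
  shows "extendable R A \<longleftrightarrow> (\<exists>e\<in>carrier R. \<exists>f\<in>carrier R. \<exists>g\<in>carrier R. \<exists>h\<in>carrier R. \<exists>i\<in>carrier R.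
    A (0, 0) \<otimes> (A (1, 1) \<otimes> i \<ominus> f \<otimes> h) \<ominus> A (0, 1) \<otimes> (A (1, 0) \<otimes> i \<ominus> f \<otimes> g) \<oplus>
    e \<otimes> (A (1, 0) \<otimes> h \<ominus> A (1, 1) \<otimes> g) = \<one>)" (is "_ \<longleftrightarrow> ?R")
proof
  assume "extendable R A"
  then obtain B where B: "B \<in> carrier (mat_module R 3 3)" "mat_det R 3 B = \<one>"
    "\<forall>i<2. \<forall>j<2. A (i, j) = B (i, j)"
    by (auto simp: extendable_def SL_def)
  have "mat_det R 3 B = B (0, 0) \<otimes> (B (1, 1) \<otimes> B (2, 2) \<ominus> B (1, 2) \<otimes> B (2, 1)) \<ominus>
    B (0, 1) \<otimes> (B (1, 0) \<otimes> B (2, 2) \<ominus> B (1, 2) \<otimes> B (2, 0)) \<oplus>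
    B (0, 2) \<otimes> (B (1, 0) \<otimes> B (2, 1) \<ominus> B (1, 1) \<otimes> B (2, 0))"
    using B(1) by (intro mat_det_3) (auto simp: mat_module_carrier)
  then show ?R
    using B by - (rule bexI[of _ "B (0, 2)"], rule bexI[of _ "B (1, 2)"], rule bexI[of _ "B (2, 0)"], rule bexI[of _ "B (2, 1)"], rule bexI[of _ "B (2, 2)"], auto simp: mat_module_carrier)
next
  assume ?R
  then obtain e f g h k where c: "e \<in> carrier R" "f \<in> carrier R" "g \<in> carrier R" "h \<in> carrier R"
      "k \<in> carrier R"
    and det: "A (0, 0) \<otimes> (A (1, 1) \<otimes> k \<ominus> f \<otimes> h) \<ominus> A (0, 1) \<otimes> (A (1, 0) \<otimes> k \<ominus> f \<otimes> g) \<oplus>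
      e \<otimes> (A (1, 0) \<otimes> h \<ominus> A (1, 1) \<otimes> g) = \<one>"
    by blast
  \<comment> \<open>\<open>A\<close> is zero outside its 2 x 2 block, so writing the five new
    entries into it already gives a matrix supported on the 3 x 3 block.\<close>
  define B where "B = A((0, 2) := e, (1, 2) := f, (2, 0) := g, (2, 1) := h, (2, 2) := k)"
  have less3: "i < 3 \<longleftrightarrow> i = 0 \<or> i = 1 \<or> i = 2" for i :: nat by auto
  have "B \<in> carrier (mat_module R 3 3)"
    using assms c by (auto simp: B_def mat_module_carrier less3)
  moreover from this have "mat_det R 3 B = \<one>"
    using det by (subst mat_det_3) (auto simp: mat_module_carrier B_def)
  ultimately show "extendable R A"
    by (auto simp: extendable_def SL_def B_def)
qed

end

lemma K_module_simps [simp]: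
  "carrier (K_module R A) =
    {v \<in> carrier (free_module R {..<2}). L_map R A v = (\<lambda>_. \<zero>\<^bsub>R\<^esub>)}"
  "add (K_module R A) = (\<lambda>v w i. v i \<oplus>\<^bsub>R\<^esub> w i)"
  "smult (K_module R A) = (\<lambda>a v i. a \<otimes>\<^bsub>R\<^esub> v i)"
  by (simp_all add: K_module_def free_module_def)

lemma Q_module_simps [simp]:
  "carrier (Q_module R A) = L_map R A ` carrier (free_module R {..<2})"
  "zero (Q_module R A) = (\<lambda>_. \<zero>\<^bsub>R\<^esub>)"
  "add (Q_module R A) = (\<lambda>v w i. v i \<oplus>\<^bsub>R\<^esub> w i)"
  "smult (Q_module R A) = (\<lambda>a v i. a \<otimes>\<^bsub>R\<^esub> v i)"
  by (simp_all add: Q_module_def free_module_def)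

section \<open>Equivalent properties of a single unimodular matrix of determinant zero\<close>

context cring
begin

lemma Um_det_zeroE:
  assumes "A \<in> Um_det_zero R"
  obtains x y z w where "A \<in> carrier (mat_module R 2 2)"
    "A (0, 0) \<in> carrier R" "A (0, 1) \<in> carrier R" "A (1, 0) \<in> carrier R" "A (1, 1) \<in> carrier R"
    "x \<in> carrier R" "y \<in> carrier R" "z \<in> carrier R" "w \<in> carrier R"
    "A (0, 0) \<otimes> A (1, 1) = A (0, 1) \<otimes> A (1, 0)"
    "A (0, 0) \<otimes> x \<oplus> A (0, 1) \<otimes> y \<oplus> (A (1, 0) \<otimes> z \<oplus> A (1, 1) \<otimes> w) = \<one>"
proof -
  have A: "A \<in> carrier (mat_module R 2 2)" and um: "A \<in> Um R (mat_module R 2 2)"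
    and det: "mat_det R 2 A = \<zero>"
    using assms by (auto simp: Um_det_zero_def Um_def)
  have c: "A (0, 0) \<in> carrier R" "A (0, 1) \<in> carrier R" "A (1, 0) \<in> carrier R" "A (1, 1) \<in> carrier R"
    using A by (auto simp: mat_module_carrier)
  have "A (0, 0) \<otimes> A (1, 1) \<ominus> A (0, 1) \<otimes> A (1, 0) = \<zero>"
    using det A by (subst (asm) mat_det_2) (auto simp: mat_module_carrier)
  then have "A (0, 0) \<otimes> A (1, 1) = A (0, 1) \<otimes> A (1, 0)"
    using c by - (rule diff_zero_imp_eq, simp_all)
  with that A c um show thesis
    by (auto simp: Um_mat_iff)
qed

lemma free2E:
  assumes "v \<in> carrier (free_module R {..<2::nat})"
  obtains x y where "v = vec2 R x y" "x \<in> carrier R" "y \<in> carrier R"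
  using free2_vec2[OF assms] assms by (auto simp: free2_carrier)

lemma Q_module_closed:
  assumes A: "A \<in> carrier (mat_module R 2 2)"
  shows "v \<in> carrier (Q_module R A) \<Longrightarrow> w \<in> carrier (Q_module R A) \<Longrightarrow>
      v \<oplus>\<^bsub>Q_module R A\<^esub> w \<in> carrier (Q_module R A)"
    and "a \<in> carrier R \<Longrightarrow> v \<in> carrier (Q_module R A) \<Longrightarrow>
      a \<odot>\<^bsub>Q_module R A\<^esub> v \<in> carrier (Q_module R A)"
    and "L_map R A \<in> linear_maps R (free_module R {..<2}) (Q_module R A)"
proof -
  have c: "A (0, 0) \<in> carrier R" "A (0, Suc 0) \<in> carrier R" "A (Suc 0, 0) \<in> carrier R"
      "A (Suc 0, Suc 0) \<in> carrier R"
    using A by (auto simp: mat_module_carrier)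
  have add: "L_map R A (\<lambda>i. v i \<oplus> w i) = (\<lambda>i. L_map R A v i \<oplus> L_map R A w i)"
    if "v \<in> carrier (free_module R {..<2})" "w \<in> carrier (free_module R {..<2})" for v w
    using that c by (elim free2E) (simp add: L_map_vec2[OF A] r_distr a_ac)
  have smult: "L_map R A (\<lambda>i. a \<otimes> v i) = (\<lambda>i. a \<otimes> L_map R A v i)"
    if "a \<in> carrier R" "v \<in> carrier (free_module R {..<2})" for a v
    using that c by (elim free2E) (simp add: L_map_vec2[OF A] r_distr m_ac)
  show "L_map R A \<in> linear_maps R (free_module R {..<2}) (Q_module R A)"
    by (intro linear_mapsI) (simp_all add: add smult)
  show "v \<in> carrier (Q_module R A) \<Longrightarrow> w \<in> carrier (Q_module R A) \<Longrightarrow>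
      v \<oplus>\<^bsub>Q_module R A\<^esub> w \<in> carrier (Q_module R A)"
    by (auto simp: add[symmetric] free2_closed)
  show "a \<in> carrier R \<Longrightarrow> v \<in> carrier (Q_module R A) \<Longrightarrow>
      a \<odot>\<^bsub>Q_module R A\<^esub> v \<in> carrier (Q_module R A)"
    by (auto simp: smult[symmetric] free2_closed)
qed

lemma Q_module_subset:
  assumes "A \<in> carrier (mat_module R 2 2)"
  shows "carrier (Q_module R A) \<subseteq> carrier (free_module R {..<2})"
proof -
  have "A (0, 0) \<in> carrier R" "A (0, Suc 0) \<in> carrier R" "A (Suc 0, 0) \<in> carrier R"
      "A (Suc 0, Suc 0) \<in> carrier R"
    using assms by (auto simp: mat_module_carrier)
  then show ?thesis
    using assms by (auto elim!: free2E simp: L_map_vec2)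
qed

text \<open>After substituting the factorization, the Bezout relation of the entries is bilinear in
  \<open>(p, q)\<close> and \<open>(r, s)\<close>. Collecting the terms with \<open>p\<close> and
  with \<open>q\<close> gives a Bezout relation of the column, collecting those with
  \<open>r\<close> and with \<open>s\<close> gives one of the row.\<close>

lemma non_full_unimodularE:
  assumes A: "A \<in> Um_det_zero R" and "non_full R A"
  obtains p q r s u1 u2 v1 v2 where
    "p \<in> carrier R" "q \<in> carrier R" "r \<in> carrier R" "s \<in> carrier R"
    "u1 \<in> carrier R" "u2 \<in> carrier R" "v1 \<in> carrier R" "v2 \<in> carrier R"
    "A (0, 0) = p \<otimes> r" "A (0, 1) = p \<otimes> s" "A (1, 0) = q \<otimes> r" "A (1, 1) = q \<otimes> s"
    "p \<otimes> u1 \<oplus> q \<otimes> u2 = \<one>" "r \<otimes> v1 \<oplus> s \<otimes> v2 = \<one>"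
proof -
  obtain x y z w where A': "A \<in> carrier (mat_module R 2 2)"
    and xyzw: "x \<in> carrier R" "y \<in> carrier R" "z \<in> carrier R" "w \<in> carrier R"
    and um: "A (0, 0) \<otimes> x \<oplus> A (0, 1) \<otimes> y \<oplus> (A (1, 0) \<otimes> z \<oplus> A (1, 1) \<otimes> w) = \<one>"
    using A by (elim Um_det_zeroE)
  obtain p q r s where pqrs: "p \<in> carrier R" "q \<in> carrier R" "r \<in> carrier R" "s \<in> carrier R"
    and eq: "A (0, 0) = p \<otimes> r" "A (0, 1) = p \<otimes> s" "A (1, 0) = q \<otimes> r" "A (1, 1) = q \<otimes> s"
    using assms(2) A' by (auto simp: non_full_iff)
  define u1 where "u1 = r \<otimes> x \<oplus> s \<otimes> y"
  define u2 where "u2 = r \<otimes> z \<oplus> s \<otimes> w"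
  define v1 where "v1 = p \<otimes> x \<oplus> q \<otimes> z"
  define v2 where "v2 = p \<otimes> y \<oplus> q \<otimes> w"
  have uv: "u1 \<in> carrier R" "u2 \<in> carrier R" "v1 \<in> carrier R" "v2 \<in> carrier R"
    using pqrs xyzw by (simp_all add: u1_def u2_def v1_def v2_def)
  have "p \<otimes> u1 \<oplus> q \<otimes> u2 = \<one>"
    using um[unfolded eq] pqrs xyzw by (simp add: u1_def u2_def r_distr m_assoc)
  moreover have "r \<otimes> v1 \<oplus> s \<otimes> v2 = \<one>"
    using um[unfolded eq] pqrs xyzw by (simp add: v1_def v2_def r_distr m_ac a_ac)
  ultimately show thesis
    by (rule that[OF pqrs uv eq])
qed

lemma non_full_imp_extendable:
  assumes A: "A \<in> Um_det_zero R" and "non_full R A"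
  shows "extendable R A"
proof -
  have A': "A \<in> carrier (mat_module R 2 2)"
    using A by (rule Um_det_zeroE)
  obtain p q r s u1 u2 v1 v2 where pqrs: "p \<in> carrier R" "q \<in> carrier R" "r \<in> carrier R" "s \<in> carrier R"
    and uv: "u1 \<in> carrier R" "u2 \<in> carrier R" "v1 \<in> carrier R" "v2 \<in> carrier R"
    and eq: "A (0, 0) = p \<otimes> r" "A (0, 1) = p \<otimes> s" "A (1, 0) = q \<otimes> r" "A (1, 1) = q \<otimes> s"
    and u: "p \<otimes> u1 \<oplus> q \<otimes> u2 = \<one>" and v: "r \<otimes> v1 \<oplus> s \<otimes> v2 = \<one>"
    using assms by (rule non_full_unimodularE)
  \<comment> \<open>The last column is \<open>(u2, - u1)\<close>, the last row is
    \<open>(- v2, v1)\<close> and the corner is 0. With these signs the determinant is the product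
    of the two Bezout expressions.\<close>
  have "p \<otimes> r \<otimes> (q \<otimes> s \<otimes> \<zero> \<ominus> \<ominus> u1 \<otimes> v1) \<ominus> p \<otimes> s \<otimes> (q \<otimes> r \<otimes> \<zero> \<ominus> \<ominus> u1 \<otimes> \<ominus> v2) \<oplus>
      u2 \<otimes> (q \<otimes> r \<otimes> v1 \<ominus> q \<otimes> s \<otimes> \<ominus> v2) = (p \<otimes> u1 \<oplus> q \<otimes> u2) \<otimes> (r \<otimes> v1 \<oplus> s \<otimes> v2)"
    using pqrs uv by algebra
  then show ?thesis
    using pqrs uv unfolding u v extendable_iff[OF A'] eq
    by - (rule bexI[of _ u2], rule bexI[of _ "\<ominus> u1"], rule bexI[of _ "\<ominus> v2"], rule bexI[of _ v1],
        rule bexI[of _ \<zero>], auto)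
qed

text \<open>The corner entry \<open>k\<close> enters the determinant of the extension with
  coefficient det A = 0, so what remains is e q - f p = 1 for the column (p, q) = A (h, -g)^T. Since
  a q = c p and b q = d p, multiplying each entry of A by e q - f p turns it into an entry of the
  product of the column (p, q) and the row (r, s) = (-f, e) A.\<close>

lemma extendable_imp_non_full:
  assumes A: "A \<in> Um_det_zero R" and "extendable R A"
  shows "non_full R A"
proof -
  define a b c d where "a = A (0, 0)" and "b = A (0, 1)" and "c = A (1, 0)" and "d = A (1, 1)"
  have A': "A \<in> carrier (mat_module R 2 2)"
    and abcd: "a \<in> carrier R" "b \<in> carrier R" "c \<in> carrier R" "d \<in> carrier R"
    and det: "a \<otimes> d = b \<otimes> c"
    using A by (auto elim!: Um_det_zeroE simp: a_def b_def c_def d_def)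
  obtain e f g h k where efghk: "e \<in> carrier R" "f \<in> carrier R" "g \<in> carrier R" "h \<in> carrier R"
      "k \<in> carrier R"
    and one: "a \<otimes> (d \<otimes> k \<ominus> f \<otimes> h) \<ominus> b \<otimes> (c \<otimes> k \<ominus> f \<otimes> g) \<oplus> e \<otimes> (c \<otimes> h \<ominus> d \<otimes> g) = \<one>"
    using assms(2) unfolding extendable_iff[OF A'] a_def b_def c_def d_def by blast
  define p where "p = a \<otimes> h \<ominus> b \<otimes> g"
  define q where "q = c \<otimes> h \<ominus> d \<otimes> g"
  define r where "r = e \<otimes> c \<ominus> f \<otimes> a"
  define s where "s = e \<otimes> d \<ominus> f \<otimes> b"
  have pqrs: "p \<in> carrier R" "q \<in> carrier R" "r \<in> carrier R" "s \<in> carrier R"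
    using abcd efghk by (simp_all add: p_def q_def r_def s_def)
  have "a \<otimes> (d \<otimes> k \<ominus> f \<otimes> h) \<ominus> b \<otimes> (c \<otimes> k \<ominus> f \<otimes> g) \<oplus> e \<otimes> (c \<otimes> h \<ominus> d \<otimes> g) =
      (a \<otimes> d \<ominus> b \<otimes> c) \<otimes> k \<oplus> (e \<otimes> q \<ominus> f \<otimes> p)"
    unfolding p_def q_def using abcd efghk by algebra
  also have "a \<otimes> d \<ominus> b \<otimes> c = \<zero>"
    using abcd by (simp add: det a_minus_def r_neg)
  finally have eq: "e \<otimes> q \<ominus> f \<otimes> p = \<one>"
    using one efghk pqrs by simp
  have aq: "a \<otimes> q = c \<otimes> p"
  proof -
    have "a \<otimes> q = a \<otimes> c \<otimes> h \<ominus> (a \<otimes> d) \<otimes> g"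
      unfolding q_def using abcd efghk by algebra
    also have "\<dots> = c \<otimes> p"
      unfolding p_def det using abcd efghk by algebra
    finally show ?thesis .
  qed
  have bq: "b \<otimes> q = d \<otimes> p"
  proof -
    have "b \<otimes> q = (b \<otimes> c) \<otimes> h \<ominus> b \<otimes> d \<otimes> g"
      unfolding q_def using abcd efghk by algebra
    also have "\<dots> = d \<otimes> p"
      unfolding p_def det[symmetric] using abcd efghk by algebra
    finally show ?thesis .
  qed
  have "a = a \<otimes> (e \<otimes> q \<ominus> f \<otimes> p)" "b = b \<otimes> (e \<otimes> q \<ominus> f \<otimes> p)"
      "c = c \<otimes> (e \<otimes> q \<ominus> f \<otimes> p)" "d = d \<otimes> (e \<otimes> q \<ominus> f \<otimes> p)"
    using abcd by (simp_all add: eq)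
  moreover have "a \<otimes> (e \<otimes> q \<ominus> f \<otimes> p) = e \<otimes> (a \<otimes> q) \<ominus> f \<otimes> a \<otimes> p"
      "b \<otimes> (e \<otimes> q \<ominus> f \<otimes> p) = e \<otimes> (b \<otimes> q) \<ominus> f \<otimes> b \<otimes> p"
      "c \<otimes> (e \<otimes> q \<ominus> f \<otimes> p) = e \<otimes> c \<otimes> q \<ominus> f \<otimes> (c \<otimes> p)"
      "d \<otimes> (e \<otimes> q \<ominus> f \<otimes> p) = e \<otimes> d \<otimes> q \<ominus> f \<otimes> (d \<otimes> p)"
    using abcd efghk pqrs by algebra+
  moreover have "e \<otimes> (c \<otimes> p) \<ominus> f \<otimes> a \<otimes> p = p \<otimes> r" "e \<otimes> (d \<otimes> p) \<ominus> f \<otimes> b \<otimes> p = p \<otimes> s"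
      "e \<otimes> c \<otimes> q \<ominus> f \<otimes> (a \<otimes> q) = q \<otimes> r" "e \<otimes> d \<otimes> q \<ominus> f \<otimes> (b \<otimes> q) = q \<otimes> s"
    unfolding r_def s_def using abcd efghk pqrs by algebra+
  ultimately have "a = p \<otimes> r \<and> b = p \<otimes> s \<and> c = q \<otimes> r \<and> d = q \<otimes> s"
    using aq bq by metis
  then show ?thesis
    using pqrs unfolding non_full_iff[OF A'] a_def b_def c_def d_def by blast
qed

text \<open>The map of A sends (x, y) to t (p, q) with t = r x + s y. As \<open>(r, s)\<close> is
  unimodular, every t occurs; as \<open>(p, q)\<close> is unimodular, t (p, q) determines t. So the
  image is free on (p, q), and the kernel is that of the functional \<open>(r, s)\<close>, which is
  free on (-s, r).\<close>

lemma non_full_imp_isos: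
  assumes A: "A \<in> Um_det_zero R" and "non_full R A"
  shows "module_iso R (Q_module R A) (self_module R)" "module_iso R (K_module R A) (self_module R)"
proof -
  have A': "A \<in> carrier (mat_module R 2 2)"
    using A by (rule Um_det_zeroE)
  obtain p q r s u1 u2 v1 v2 where pqrs: "p \<in> carrier R" "q \<in> carrier R" "r \<in> carrier R" "s \<in> carrier R"
    and uv: "u1 \<in> carrier R" "u2 \<in> carrier R" "v1 \<in> carrier R" "v2 \<in> carrier R"
    and eq: "A (0, 0) = p \<otimes> r" "A (0, 1) = p \<otimes> s" "A (1, 0) = q \<otimes> r" "A (1, 1) = q \<otimes> s"
    and u: "p \<otimes> u1 \<oplus> q \<otimes> u2 = \<one>" and v: "r \<otimes> v1 \<oplus> s \<otimes> v2 = \<one>"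
    using assms by (rule non_full_unimodularE)
  have L: "L_map R A (vec2 R x y) = vec2 R (p \<otimes> (r \<otimes> x \<oplus> s \<otimes> y)) (q \<otimes> (r \<otimes> x \<oplus> s \<otimes> y))"
    if "x \<in> carrier R" "y \<in> carrier R" for x y
    using that pqrs by (simp add: L_map_vec2[OF A'] eq[simplified] r_distr m_assoc)
  have cancel: "t = \<zero>" if "t \<in> carrier R" "p \<otimes> t = \<zero>" "q \<otimes> t = \<zero>" for t
  proof -
    have "t = (p \<otimes> u1 \<oplus> q \<otimes> u2) \<otimes> t" using that u by simp
    also have "\<dots> = u1 \<otimes> (p \<otimes> t) \<oplus> u2 \<otimes> (q \<otimes> t)"
      using that(1) pqrs uv by algebra
    finally show ?thesis using that uv by simp
  qed
  \<comment> \<open>The first identity makes \<open>F\<close> below injective, the second does the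
    same for \<open>G\<close>.\<close>
  have recover: "t = u1 \<otimes> (p \<otimes> t) \<oplus> u2 \<otimes> (q \<otimes> t)" "t = v1 \<otimes> (r \<otimes> t) \<oplus> v2 \<otimes> (s \<otimes> t)"
    if "t \<in> carrier R" for t
  proof -
    have "t = (p \<otimes> u1 \<oplus> q \<otimes> u2) \<otimes> t" "t = (r \<otimes> v1 \<oplus> s \<otimes> v2) \<otimes> t"
      using that u v by simp_all
    then show "t = u1 \<otimes> (p \<otimes> t) \<oplus> u2 \<otimes> (q \<otimes> t)" "t = v1 \<otimes> (r \<otimes> t) \<oplus> v2 \<otimes> (s \<otimes> t)"
      using that pqrs uv by algebra+
  qed
  define F where "F t = vec2 R (p \<otimes> t) (q \<otimes> t)" for t
  \<comment> \<open>On the vector (v1 t, v2 t) the functional \<open>(r, s)\<close> takes the value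
    t, by its Bezout relation.\<close>
  have F: "F t = L_map R A (vec2 R (v1 \<otimes> t) (v2 \<otimes> t))" if "t \<in> carrier R" for t
  proof -
    have "r \<otimes> (v1 \<otimes> t) \<oplus> s \<otimes> (v2 \<otimes> t) = (r \<otimes> v1 \<oplus> s \<otimes> v2) \<otimes> t"
      using that pqrs uv by algebra
    then show ?thesis
      using that pqrs uv v by (simp add: L F_def)
  qed
  have "module_iso R (self_module R) (Q_module R A)"
    unfolding module_iso_def
  proof (intro bexI[of _ F] linear_mapsI)
    show "bij_betw F (carrier (self_module R)) (carrier (Q_module R A))"
    proof (rule bij_betwI')
      fix s t assume "s \<in> carrier (self_module R)" "t \<in> carrier (self_module R)"
      then show "(F s = F t) = (s = t)"
        using recover(1)[of s] recover(1)[of t] by (auto simp: F_def)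
    next
      fix t assume "t \<in> carrier (self_module R)"
      then show "F t \<in> carrier (Q_module R A)"
        using F uv by simp
    next
      fix V assume "V \<in> carrier (Q_module R A)"
      then obtain x y where "V = L_map R A (vec2 R x y)" "x \<in> carrier R" "y \<in> carrier R"
        by (auto elim: free2E)
      then have "V = F (r \<otimes> x \<oplus> s \<otimes> y)" "r \<otimes> x \<oplus> s \<otimes> y \<in> carrier R"
        using pqrs by (simp_all add: L F_def)
      then show "\<exists>t\<in>carrier (self_module R). V = F t" by auto
    qed
  next
    show "t \<in> carrier (self_module R) \<Longrightarrow> F t \<in> carrier (Q_module R A)" for t
      using F uv by simp
  qed (use pqrs in \<open>simp_all add: F_def r_distr m_ac\<close>)
  then show "module_iso R (Q_module R A) (self_module R)"
    by (rule module_iso_sym) auto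
  have K: "vec2 R x y \<in> carrier (K_module R A) \<longleftrightarrow> r \<otimes> x \<oplus> s \<otimes> y = \<zero>"
    if "x \<in> carrier R" "y \<in> carrier R" for x y
    using that pqrs cancel[of "r \<otimes> x \<oplus> s \<otimes> y"] by (auto simp: L vec2_zero)
  define G where "G t = vec2 R (\<ominus> s \<otimes> t) (r \<otimes> t)" for t
  have G: "G t \<in> carrier (K_module R A)" if "t \<in> carrier R" for t
  proof -
    have "r \<otimes> (\<ominus> s \<otimes> t) \<oplus> s \<otimes> (r \<otimes> t) = \<zero>"
      using that pqrs by algebra
    then show ?thesis
      unfolding G_def using that pqrs by (subst K) simp_all
  qed
  have "module_iso R (self_module R) (K_module R A)"
    unfolding module_iso_def
  proof (intro bexI[of _ G] linear_mapsI)
    show "bij_betw G (carrier (self_module R)) (carrier (K_module R A))"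
    proof (rule bij_betwI')
      fix a b assume ab: "a \<in> carrier (self_module R)" "b \<in> carrier (self_module R)"
      have "a = b" if "G a = G b"
      proof -
        from that have "s \<otimes> a = s \<otimes> b" "r \<otimes> a = r \<otimes> b"
          using ab pqrs by (auto simp: G_def l_minus dest: arg_cong[of _ _ "a_inv R"])
        with recover(2)[of a] recover(2)[of b] ab show ?thesis by simp
      qed
      then show "(G a = G b) = (a = b)" by auto
    next
      fix t assume "t \<in> carrier (self_module R)"
      then show "G t \<in> carrier (K_module R A)" using G by simp
    next
      fix V assume V: "V \<in> carrier (K_module R A)"
      then obtain x y where xy: "V = vec2 R x y" "x \<in> carrier R" "y \<in> carrier R"
        by (auto elim: free2E)
      with V have zero: "r \<otimes> x \<oplus> s \<otimes> y = \<zero>"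
        using K by blast
      \<comment> \<open>The coordinate of (x, y) with respect to (-s, r): the determinant of (v1,
        v2) and (x, y). The identities below express -s t and r t through the Bezout relation and r
        x + s y, which is zero here.\<close>
      define t where "t = v1 \<otimes> y \<ominus> v2 \<otimes> x"
      have t: "t \<in> carrier R"
        using xy uv by (simp add: t_def)
      have "\<ominus> s \<otimes> t = (r \<otimes> v1 \<oplus> s \<otimes> v2) \<otimes> x \<ominus> v1 \<otimes> (r \<otimes> x \<oplus> s \<otimes> y)"
        unfolding t_def using xy uv pqrs by algebra
      then have "\<ominus> s \<otimes> t = x"
        using xy uv by (simp add: zero v a_minus_def)
      moreover have "r \<otimes> t = (r \<otimes> v1 \<oplus> s \<otimes> v2) \<otimes> y \<ominus> v2 \<otimes> (r \<otimes> x \<oplus> s \<otimes> y)"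
        unfolding t_def using xy uv pqrs by algebra
      then have "r \<otimes> t = y"
        using xy uv by (simp add: zero v a_minus_def)
      ultimately have "V = G t" by (simp add: G_def xy(1))
      with t show "\<exists>t\<in>carrier (self_module R). V = G t" by auto
    qed
  next
    show "t \<in> carrier (self_module R) \<Longrightarrow> G t \<in> carrier (K_module R A)" for t
      using G by simp
  qed (use pqrs in \<open>simp_all add: G_def r_distr m_ac\<close>)
  then show "module_iso R (K_module R A) (self_module R)"
    by (rule module_iso_sym) auto
qed

lemma K_iso_imp_non_full:
  assumes A: "A \<in> Um_det_zero R" and "module_iso R (K_module R A) (self_module R)"
  shows "non_full R A"
proof -
  define a b c d where "a = A (0, 0)" and "b = A (0, 1)" and "c = A (1, 0)" and "d = A (1, 1)"
  have A': "A \<in> carrier (mat_module R 2 2)"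
    and abcd: "a \<in> carrier R" "b \<in> carrier R" "c \<in> carrier R" "d \<in> carrier R"
    and det: "a \<otimes> d = b \<otimes> c"
    using A by (auto elim!: Um_det_zeroE simp: a_def b_def c_def d_def)
  obtain f where f: "f \<in> linear_maps R (K_module R A) (self_module R)"
      "bij_betw f (carrier (K_module R A)) (carrier R)"
    using assms(2) by (auto simp: module_iso_def)
  obtain k where k: "k \<in> carrier (K_module R A)" "f k = \<one>"
    using bij_betw_imp_surj_on[OF f(2)] one_closed by (metis imageE)
  obtain k0 k1 where k01: "k = vec2 R k0 k1" "k0 \<in> carrier R" "k1 \<in> carrier R"
    using k(1) by (auto elim: free2E)
  have multiple: "\<exists>t\<in>carrier R. x = t \<otimes> k0 \<and> y = t \<otimes> k1"
    if xy: "vec2 R x y \<in> carrier (K_module R A)" for x y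
  proof -
    define t where "t = f (vec2 R x y)"
    have t: "t \<in> carrier R"
      using linear_mapsD(1)[OF f(1) xy] by (simp add: t_def)
    have tk: "vec2 R (t \<otimes> k0) (t \<otimes> k1) \<in> carrier (K_module R A)"
      using k(1) t k01 abcd
      by (auto simp: L_map_vec2[OF A'] a_def b_def c_def d_def vec2_zero m_lcomm[of _ t] r_distr[symmetric])
    have "f (vec2 R (t \<otimes> k0) (t \<otimes> k1)) = t"
      using linear_mapsD(3)[OF f(1) t k(1)] t k(2) by (simp add: k01(1))
    \<comment> \<open>As f k = 1, the vectors t k and (x, y) have the same image t under
      \<open>f\<close>, which is injective on the kernel.\<close>
    then have "vec2 R (t \<otimes> k0) (t \<otimes> k1) = vec2 R x y"
      by (intro inj_onD[OF bij_betw_imp_inj_on[OF f(2)] _ tk xy]) (simp only: t_def)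
    with t show ?thesis by auto
  qed
  \<comment> \<open>These are the columns of the adjugate. Their membership in the kernel is the
    relation A adj(A) = det(A) I = 0.\<close>
  have "vec2 R d (\<ominus> c) \<in> carrier (K_module R A)" "vec2 R (\<ominus> b) a \<in> carrier (K_module R A)"
    using abcd det
    by (auto simp: L_map_vec2[OF A'] vec2_zero r_minus r_neg l_neg m_comm
        simp flip: a_def b_def c_def d_def One_nat_def)
  then obtain t t' where t: "t \<in> carrier R" "d = t \<otimes> k0" "\<ominus> c = t \<otimes> k1"
    and t': "t' \<in> carrier R" "\<ominus> b = t' \<otimes> k0" "a = t' \<otimes> k1"
    using multiple by meson
  \<comment> \<open>Undoing the signs of the adjugate gives A as the product of the column (t', -t)
    and the row (k1, -k0).\<close>
  have "b = t' \<otimes> \<ominus> k0" "c = \<ominus> t \<otimes> k1" "d = \<ominus> t \<otimes> \<ominus> k0"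
    using t t' k01 abcd minus_minus[of b] minus_minus[of c] by (simp_all add: r_minus l_minus)
  with t t' k01 show ?thesis
    unfolding non_full_iff[OF A'] a_def[symmetric] b_def[symmetric] c_def[symmetric] d_def[symmetric]
    by - (rule bexI[of _ t'], rule bexI[of _ "\<ominus> t"], rule bexI[of _ k1], rule bexI[of _ "\<ominus> k0"], auto)
qed

lemma non_full_imp_factors:
  assumes A: "A \<in> carrier (mat_module R 2 2)" and "non_full R A"
  shows "factors_through_R R A"
proof -
  obtain p q r s where pqrs: "p \<in> carrier R" "q \<in> carrier R" "r \<in> carrier R" "s \<in> carrier R"
    and eq: "A (0, 0) = p \<otimes> r" "A (0, 1) = p \<otimes> s" "A (1, 0) = q \<otimes> r" "A (1, 1) = q \<otimes> s"
    using assms by (auto simp: non_full_iff)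
  define f where "f v = r \<otimes> v 0 \<oplus> s \<otimes> v 1" for v :: "nat \<Rightarrow> 'a"
  define g where "g t = vec2 R (p \<otimes> t) (q \<otimes> t)" for t
  have "f \<in> linear_maps R (free_module R {..<2}) (self_module R)"
    using pqrs
    by (intro linear_mapsI) (simp_all add: free2_carrier f_def r_distr m_ac a_ac)
  moreover have "g \<in> linear_maps R (self_module R) (free_module R {..<2})"
    using pqrs by (intro linear_mapsI) (simp_all add: g_def r_distr m_ac)
  moreover have "L_map R A v = g (f v)" if "v \<in> carrier (free_module R {..<2})" for v
    using that pqrs
    by (elim free2E) (simp add: L_map_vec2[OF A] eq[simplified] f_def g_def r_distr m_assoc)
  ultimately show ?thesis
    by (auto simp: factors_through_R_def)
qed

text \<open>The map \<open>g\<close> is multiplication by the vector \<open>g \<one>\<close>, which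
  is the column of the factorization; the values of \<open>f\<close> at the two standard basis
  vectors form the row.\<close>

lemma factors_imp_non_full:
  assumes A: "A \<in> carrier (mat_module R 2 2)" and "factors_through_R R A"
  shows "non_full R A"
proof -
  obtain f g where f: "f \<in> linear_maps R (free_module R {..<2::nat}) (self_module R)"
    and g: "g \<in> linear_maps R (self_module R) (free_module R {..<2})"
    and fg: "\<And>v. v \<in> carrier (free_module R {..<2}) \<Longrightarrow> L_map R A v = g (f v)"
    using assms(2) by (auto simp: factors_through_R_def)
  have c: "A (0, 0) \<in> carrier R" "A (0, Suc 0) \<in> carrier R" "A (Suc 0, 0) \<in> carrier R"
      "A (Suc 0, Suc 0) \<in> carrier R"
    using A by (auto simp: mat_module_carrier)
  obtain p q where pq: "g \<one> = vec2 R p q" "p \<in> carrier R" "q \<in> carrier R"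
    using linear_mapsD(1)[OF g, of \<one>] by (auto elim: free2E)
  have gt: "g t = vec2 R (p \<otimes> t) (q \<otimes> t)" if "t \<in> carrier R" for t
    using linear_mapsD(3)[OF g, of t \<one>] that pq by (simp add: m_comm)
  define r where "r = f (vec2 R \<one> \<zero>)"
  define s where "s = f (vec2 R \<zero> \<one>)"
  have rs: "r \<in> carrier R" "s \<in> carrier R"
    using linear_mapsD(1)[OF f] by (simp_all add: r_def s_def)
  have "L_map R A (vec2 R \<one> \<zero>) = vec2 R (p \<otimes> r) (q \<otimes> r)"
    "L_map R A (vec2 R \<zero> \<one>) = vec2 R (p \<otimes> s) (q \<otimes> s)"
    using rs by (simp_all add: fg gt flip: r_def s_def)
  then show ?thesis
    using c pq rs unfolding non_full_iff[OF A]
    by - (rule bexI[of _ p], rule bexI[of _ q], rule bexI[of _ r], rule bexI[of _ s],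
        auto simp: L_map_vec2[OF A])
qed

text \<open>The map of A is a surjection onto its image followed by the inclusion into R^2.
  Inserting an isomorphism of the image with \<open>R\<close> and its inverse between the two gives
  the factorization.\<close>

lemma Q_iso_imp_factors:
  assumes A: "A \<in> carrier (mat_module R 2 2)" and iso: "module_iso R (Q_module R A) (self_module R)"
  shows "factors_through_R R A"
proof -
  obtain f where f: "f \<in> linear_maps R (Q_module R A) (self_module R)"
      "bij_betw f (carrier (Q_module R A)) (carrier (self_module R))"
    using iso by (auto simp: module_iso_def)
  \<comment> \<open>\<open>module_iso_sym\<close> would only assert that some isomorphism exists in
    the other direction; here the inverse of this very \<open>f\<close> is required.\<close>
  define g where "g = inv_into (carrier (Q_module R A)) f"
  have gc: "g t \<in> carrier (Q_module R A)" "f (g t) = t" if "t \<in> carrier R" for t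
    using that f(2) by (simp_all add: g_def bij_betw_inv_into_right bij_betw_imp_surj_on inv_into_into
        del: Q_module_simps)
  have gf: "g (f v) = v" if "v \<in> carrier (Q_module R A)" for v
    using that f(2) by (simp add: g_def bij_betw_inv_into_left del: Q_module_simps)
  have "(\<lambda>v. f (L_map R A v)) \<in> linear_maps R (free_module R {..<2}) (self_module R)"
    using Q_module_closed(3)[OF A] f(1) by (rule linear_maps_comp)
  moreover have "g \<in> linear_maps R (self_module R) (free_module R {..<2})"
  proof (rule linear_mapsI)
    fix t assume "t \<in> carrier (self_module R)"
    then show "g t \<in> carrier (free_module R {..<2})"
      using gc(1) Q_module_subset[OF A] by auto
  next
    fix t u assume tu: "t \<in> carrier (self_module R)" "u \<in> carrier (self_module R)"
    then have "f (g t \<oplus>\<^bsub>Q_module R A\<^esub> g u) = t \<oplus> u"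
      using linear_mapsD(2)[OF f(1)] gc by (simp del: Q_module_simps)
    then show "g (t \<oplus>\<^bsub>self_module R\<^esub> u) = g t \<oplus>\<^bsub>free_module R {..<2}\<^esub> g u"
      using gf[OF Q_module_closed(1)[OF A gc(1) gc(1)], of t u] tu by simp
  next
    fix a t assume at: "a \<in> carrier R" "t \<in> carrier (self_module R)"
    then have "f (a \<odot>\<^bsub>Q_module R A\<^esub> g t) = a \<otimes> t"
      using linear_mapsD(3)[OF f(1)] gc by (simp del: Q_module_simps)
    then show "g (a \<odot>\<^bsub>self_module R\<^esub> t) = a \<odot>\<^bsub>free_module R {..<2}\<^esub> g t"
      using gf[OF Q_module_closed(2)[OF A at(1) gc(1)], of t] at by simp
  qed
  moreover have "L_map R A v = g (f (L_map R A v))" if "v \<in> carrier (free_module R {..<2})" for v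
    using that gf by simp
  ultimately show ?thesis
    unfolding factors_through_R_def
    by - (rule bexI[of _ "\<lambda>v. f (L_map R A v)"], rule bexI[of _ g], auto)
qed

text \<open>Kernel and image are related to each other only through \<open>non_full\<close>; this is
  how freeness of one of them passes to the other.\<close>

lemma non_full_equivalences:
  assumes A: "A \<in> Um_det_zero R"
  shows "extendable R A \<longleftrightarrow> non_full R A"
    and "non_full R A \<longleftrightarrow> factors_through_R R A"
    and "module_iso R (K_module R A) (self_module R) \<longleftrightarrow> non_full R A"
    and "module_iso R (Q_module R A) (self_module R) \<longleftrightarrow> non_full R A"
proof -
  have A': "A \<in> carrier (mat_module R 2 2)"
    using A by (rule Um_det_zeroE)
  show "extendable R A \<longleftrightarrow> non_full R A"
    using non_full_imp_extendable[OF A] extendable_imp_non_full[OF A] by blast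
  show "non_full R A \<longleftrightarrow> factors_through_R R A"
    using non_full_imp_factors[OF A'] factors_imp_non_full[OF A'] by blast
  show "module_iso R (K_module R A) (self_module R) \<longleftrightarrow> non_full R A"
    using non_full_imp_isos(2)[OF A] K_iso_imp_non_full[OF A] by blast
  show "module_iso R (Q_module R A) (self_module R) \<longleftrightarrow> non_full R A"
    using non_full_imp_isos(1)[OF A] Q_iso_imp_factors[OF A'] factors_imp_non_full[OF A'] by blast
qed

end

section \<open>Projective modules with two generators\<close>

text \<open>Zorn's lemma applies to the ideals above \<open>I\<close> that avoid
  \<open>\<one>\<close>, a form of properness that passes to unions of chains. A maximal member is a
  maximal ideal, because a larger ideal either contains \<open>\<one>\<close> or belongs to the same
  family.\<close>

lemma (in cring) exists_maximalideal:
  assumes "ideal I R" "\<one> \<notin> I"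
  shows "\<exists>J. maximalideal J R \<and> I \<subseteq> J"
proof -
  let ?A = "{J. ideal J R \<and> I \<subseteq> J \<and> \<one> \<notin> J}"
  have "\<exists>J\<in>?A. \<forall>X\<in>?A. J \<subseteq> X \<longrightarrow> X = J"
  proof (rule subset_Zorn_nonempty)
    fix C assume C: "C \<noteq> {}" "subset.chain ?A C"
    have ideals: "ideal J R" if "J \<in> C" for J
      using C(2) that by (auto simp: subset_chain_def)
    have add_sub: "additive_subgroup J R" if "J \<in> C" for J
      using ideals[OF that] by (rule ideal.axioms(1))
    have common: "\<exists>J\<in>C. x \<in> J \<and> y \<in> J" if "x \<in> \<Union>C" "y \<in> \<Union>C" for x y
      using C(2) that unfolding subset_chain_def by blast
    have "ideal (\<Union>C) R"
    proof (rule idealI[OF ring_axioms])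
      show "subgroup (\<Union>C) (add_monoid R)"
      proof (rule add.subgroupI)
        show "\<Union>C \<subseteq> carrier R"
          using additive_subgroup.a_subset[OF add_sub] by blast
        show "\<Union>C \<noteq> {}"
          using C(1) additive_subgroup.zero_closed[OF add_sub] by blast
        show "\<ominus> x \<in> \<Union>C" if "x \<in> \<Union>C" for x
          using that additive_subgroup.a_inv_closed[OF add_sub] by blast
        show "x \<oplus> y \<in> \<Union>C" if "x \<in> \<Union>C" "y \<in> \<Union>C" for x y
          using common[OF that] additive_subgroup.a_closed[OF add_sub] by blast
      qed
    next
      fix x a assume "x \<in> \<Union>C" "a \<in> carrier R"
      then show "a \<otimes> x \<in> \<Union>C" "x \<otimes> a \<in> \<Union>C"
        using ideal.I_l_closed[OF ideals] ideal.I_r_closed[OF ideals] by blast+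
    qed
    then show "\<Union>C \<in> ?A"
      using C unfolding subset_chain_def by blast
  qed (use assms in auto)
  then obtain J where J: "J \<in> ?A" and max: "\<forall>X\<in>?A. J \<subseteq> X \<longrightarrow> X = J"
    by (rule bexE)
  have "maximalideal J R"
  proof (rule maximalidealI)
    show "ideal J R" "carrier R \<noteq> J" using J by auto
    fix X assume X: "ideal X R" "J \<subseteq> X" "X \<subseteq> carrier R"
    show "X = J \<or> X = carrier R"
    proof (cases "\<one> \<in> X")
      case True
      then show ?thesis using ideal.one_imp_carrier[OF X(1)] by simp
    next
      case False
      then have "X \<in> ?A" using J X by blast
      then show ?thesis using X max by simp
    qed
  qed
  with J show ?thesis by auto
qed

text \<open>The annihilator of a nonzero \<open>z\<close> avoids \<open>\<one>\<close>, so it lies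
  in a maximal ideal. This ideal is prime, and the hypothesis gives an annihilating element outside
  of it, a contradiction.\<close>

lemma (in cring) locally_zero_imp_zero:
  assumes z: "z \<in> carrier R"
    and local: "\<And>P. primeideal P R \<Longrightarrow> \<exists>t\<in>carrier R - P. t \<otimes> z = \<zero>"
  shows "z = \<zero>"
proof (rule ccontr)
  assume "z \<noteq> \<zero>"
  let ?I = "{t \<in> carrier R. t \<otimes> z = \<zero>}"
  have "ideal ?I R"
  proof (rule idealI[OF ring_axioms])
    show "subgroup ?I (add_monoid R)"
      using z by unfold_locales (auto simp: l_distr l_minus simp flip: a_inv_def)
  next
    fix t x assume t: "t \<in> ?I" and x: "x \<in> carrier R"
    have "x \<otimes> t \<otimes> z = \<zero>"
      using t x z by (simp add: m_assoc)
    then show "x \<otimes> t \<in> ?I" "t \<otimes> x \<in> ?I"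
      using t x by (simp_all add: m_comm[of t x])
  qed
  moreover have "\<one> \<notin> ?I"
    using z \<open>z \<noteq> \<zero>\<close> by simp
  ultimately obtain J where "maximalideal J R" "?I \<subseteq> J"
    using exists_maximalideal by blast
  then show False
    using local[OF maximalideal_prime] by blast
qed

section \<open>Dual bases for modules with two generators\<close>

lemma generated_submodule_pair:
  fixes R (structure) and M :: "('a, 'm) module"
  assumes "module R M" and "x \<in> carrier M" "y \<in> carrier M"
  shows "generated_submodule R M {x, y} =
    {a \<odot>\<^bsub>M\<^esub> x \<oplus>\<^bsub>M\<^esub> b \<odot>\<^bsub>M\<^esub> y | a b. a \<in> carrier R \<and> b \<in> carrier R}" (is "_ = ?H")
proof
  interpret module R M by fact
  have "submodule ?H R M"
  proof (rule submoduleI)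
    show "\<zero>\<^bsub>M\<^esub> \<in> ?H"
      using assms by (auto intro!: exI[of _ \<zero>])
  next
    fix u assume "u \<in> ?H"
    then obtain a b where u: "a \<in> carrier R" "b \<in> carrier R" "u = a \<odot>\<^bsub>M\<^esub> x \<oplus>\<^bsub>M\<^esub> b \<odot>\<^bsub>M\<^esub> y"
      by auto
    then have "\<ominus>\<^bsub>M\<^esub> u = (\<ominus> a) \<odot>\<^bsub>M\<^esub> x \<oplus>\<^bsub>M\<^esub> (\<ominus> b) \<odot>\<^bsub>M\<^esub> y"
      using assms by (simp add: smult_l_minus M.minus_add)
    with u(1,2) show "\<ominus>\<^bsub>M\<^esub> u \<in> ?H"
      by (auto intro: exI[of _ "\<ominus> a"])
  next
    fix u v assume "u \<in> ?H" "v \<in> ?H"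
    then obtain a b c d where u: "a \<in> carrier R" "b \<in> carrier R" "u = a \<odot>\<^bsub>M\<^esub> x \<oplus>\<^bsub>M\<^esub> b \<odot>\<^bsub>M\<^esub> y"
      and v: "c \<in> carrier R" "d \<in> carrier R" "v = c \<odot>\<^bsub>M\<^esub> x \<oplus>\<^bsub>M\<^esub> d \<odot>\<^bsub>M\<^esub> y"
      by auto
    then have "u \<oplus>\<^bsub>M\<^esub> v = (a \<oplus> c) \<odot>\<^bsub>M\<^esub> x \<oplus>\<^bsub>M\<^esub> (b \<oplus> d) \<odot>\<^bsub>M\<^esub> y"
      using assms by (simp add: smult_l_distr M.a_ac)
    with u(1,2) v(1,2) show "u \<oplus>\<^bsub>M\<^esub> v \<in> ?H"
      by (auto intro: exI[of _ "a \<oplus> c"])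
  next
    fix c u assume c: "c \<in> carrier R" and "u \<in> ?H"
    then obtain a b where u: "a \<in> carrier R" "b \<in> carrier R" "u = a \<odot>\<^bsub>M\<^esub> x \<oplus>\<^bsub>M\<^esub> b \<odot>\<^bsub>M\<^esub> y"
      by auto
    then have "c \<odot>\<^bsub>M\<^esub> u = (c \<otimes> a) \<odot>\<^bsub>M\<^esub> x \<oplus>\<^bsub>M\<^esub> (c \<otimes> b) \<odot>\<^bsub>M\<^esub> y"
      using assms c by (simp add: smult_r_distr smult_assoc1)
    with u(1,2) c show "c \<odot>\<^bsub>M\<^esub> u \<in> ?H"
      by (auto intro: exI[of _ "c \<otimes> a"])
  qed (use assms in auto)
  moreover have "x = \<one> \<odot>\<^bsub>M\<^esub> x \<oplus>\<^bsub>M\<^esub> \<zero> \<odot>\<^bsub>M\<^esub> y" "y = \<zero> \<odot>\<^bsub>M\<^esub> x \<oplus>\<^bsub>M\<^esub> \<one> \<odot>\<^bsub>M\<^esub> y"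
    using assms by simp_all
  then have "{x, y} \<subseteq> ?H"
    by blast
  ultimately show "generated_submodule R M {x, y} \<subseteq> ?H"
    unfolding generated_submodule_def by blast
  show "?H \<subseteq> generated_submodule R M {x, y}"
    using submoduleE(4,5) by (fastforce simp: generated_submodule_def)
qed

text \<open>The maps m |-> (f m, g m) and (s, t) |-> s x + t y present M as a summand of R^2. The
  index set must consist of elements of \<open>M\<close>, so \<open>{x, y}\<close> is taken; if the
  generators coincide it has one element, and the two coordinates are added up to
  \<open>f m \<oplus> g m\<close>.\<close>

lemma dual_basis_imp_projective:
  fixes R (structure) and M :: "('a, 'm) module"
  assumes "module R M"
    and xy: "x \<in> carrier M" "y \<in> carrier M"
    and fg: "f \<in> linear_maps R M (self_module R)" "g \<in> linear_maps R M (self_module R)"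
    and m: "\<And>m. m \<in> carrier M \<Longrightarrow> f m \<odot>\<^bsub>M\<^esub> x \<oplus>\<^bsub>M\<^esub> g m \<odot>\<^bsub>M\<^esub> y = m"
  shows "projective R M"
proof -
  interpret module R M by fact
  note lin = linear_mapsD[OF fg(1), simplified] linear_mapsD[OF fg(2), simplified]
  note free = free_module_carrier_finite[of "{x, y}"] free_module_carrier_finite[of "{y}"]
  have "\<exists>s\<in>linear_maps R M (free_module R {x, y}). \<exists>p\<in>linear_maps R (free_module R {x, y}) M.
      \<forall>m\<in>carrier M. p (s m) = m"
  proof (cases "x = y")
    case True
    define s where "s = (\<lambda>m i. if i = y then f m \<oplus> g m else \<zero>)"
    define p where "p v = v y \<odot>\<^bsub>M\<^esub> y" for v :: "'m \<Rightarrow> 'a"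
    have "s \<in> linear_maps R M (free_module R {x, y})"
      by (rule linear_mapsI) (auto simp: True free s_def lin r_distr R.a_ac fun_eq_iff)
    moreover have "p \<in> linear_maps R (free_module R {x, y}) M"
      by (rule linear_mapsI) (use xy in \<open>auto simp: True free p_def smult_l_distr smult_assoc1\<close>)
    moreover have "\<forall>m\<in>carrier M. p (s m) = m"
      using m xy by (simp add: True s_def p_def smult_l_distr lin)
    ultimately show ?thesis by blast
  next
    case False
    define s where "s = (\<lambda>m i. if i = x then f m else if i = y then g m else \<zero>)"
    define p where "p v = v x \<odot>\<^bsub>M\<^esub> x \<oplus>\<^bsub>M\<^esub> v y \<odot>\<^bsub>M\<^esub> y" for v :: "'m \<Rightarrow> 'a"
    have "s \<in> linear_maps R M (free_module R {x, y})"
      by (rule linear_mapsI) (auto simp: free s_def lin fun_eq_iff)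
    moreover have "p \<in> linear_maps R (free_module R {x, y}) M"
      by (rule linear_mapsI)
        (use xy in \<open>auto simp: free p_def smult_l_distr smult_r_distr smult_assoc1 M.a_ac\<close>)
    moreover have "\<forall>m\<in>carrier M. p (s m) = m"
      using m xy False by (simp add: s_def p_def)
    ultimately show ?thesis by blast
  qed
  then show ?thesis
    using module_axioms unfolding projective_def by blast
qed

text \<open>The free module that contains M may have infinite rank and a basis unrelated to
  \<open>x\<close> and \<open>y\<close>. Writing the image under \<open>p\<close> of each basis
  vector as a combination of \<open>x\<close> and \<open>y\<close>, and weighting the coordinates of
  \<open>s m\<close> by the coefficients, gives the two functionals.\<close>

lemma projective_imp_dual_basis:
  fixes R (structure) and M :: "('a, 'm) module"
  assumes "projective R M"
    and xy: "x \<in> carrier M" "y \<in> carrier M" "generated_submodule R M {x, y} = carrier M"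
  obtains f g where "f \<in> linear_maps R M (self_module R)" "g \<in> linear_maps R M (self_module R)"
    "\<And>m. m \<in> carrier M \<Longrightarrow> f m \<odot>\<^bsub>M\<^esub> x \<oplus>\<^bsub>M\<^esub> g m \<odot>\<^bsub>M\<^esub> y = m"
proof -
  interpret module R M
    using assms(1) by (simp add: projective_def)
  obtain I :: "'m set" and s p where s: "s \<in> linear_maps R M (free_module R I)"
    and p: "p \<in> linear_maps R (free_module R I) M" and ps: "\<And>m. m \<in> carrier M \<Longrightarrow> p (s m) = m"
    using assms(1) unfolding projective_def by blast
  have span: "\<exists>a\<in>carrier R. \<exists>b\<in>carrier R. m = a \<odot>\<^bsub>M\<^esub> x \<oplus>\<^bsub>M\<^esub> b \<odot>\<^bsub>M\<^esub> y" if "m \<in> carrier M" for m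
    using that generated_submodule_pair[OF module_axioms xy(1,2)] xy(3) by blast
  have free: "carrier (free_module R I) = {v. (\<forall>i\<in>I. v i \<in> carrier R) \<and>
      (\<forall>i. i \<notin> I \<longrightarrow> v i = \<zero>) \<and> finite {i. v i \<noteq> \<zero>}}"
    by (simp add: free_module_def)
  \<comment> \<open>As \<open>x\<close> and \<open>y\<close> generate M, every \<open>s m\<close> is
    supported in the union of these two supports. A finite set independent of \<open>m\<close>
    allows sums over \<open>J\<close> to be linear in \<open>m\<close>.\<close>
  define J where "J = {i. s x i \<noteq> \<zero>} \<union> {i. s y i \<noteq> \<zero>}"
  have sc: "s m \<in> carrier (free_module R I)" if "m \<in> carrier M" for m
    using linear_mapsD(1)[OF s that] .
  have J: "finite J" "J \<subseteq> I"
    using sc[OF xy(1)] sc[OF xy(2)] by (auto simp: J_def free)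
  have supp: "s m i = \<zero>" if m: "m \<in> carrier M" and i: "i \<notin> J" for m i
  proof -
    obtain a b where ab: "a \<in> carrier R" "b \<in> carrier R" "m = a \<odot>\<^bsub>M\<^esub> x \<oplus>\<^bsub>M\<^esub> b \<odot>\<^bsub>M\<^esub> y"
      using span[OF m] by blast
    have "s m = s (a \<odot>\<^bsub>M\<^esub> x) \<oplus>\<^bsub>free_module R I\<^esub> s (b \<odot>\<^bsub>M\<^esub> y)"
      unfolding ab(3) using ab xy by (intro linear_mapsD(2)[OF s]) auto
    then have "s m i = a \<otimes> s x i \<oplus> b \<otimes> s y i"
      using ab xy by (simp add: linear_mapsD(3)[OF s])
    then show ?thesis
      using i ab by (simp add: J_def)
  qed
  define e where "e i = (\<lambda>j. if j = i then \<one> else \<zero>)" for i :: 'm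
  have e: "e i \<in> carrier (free_module R I)" if "i \<in> I" for i
    using that by (auto simp: free e_def)
  have "\<forall>i\<in>I. \<exists>a b. a \<in> carrier R \<and> b \<in> carrier R \<and> p (e i) = a \<odot>\<^bsub>M\<^esub> x \<oplus>\<^bsub>M\<^esub> b \<odot>\<^bsub>M\<^esub> y"
    using span linear_mapsD(1)[OF p e] by blast
  then obtain \<alpha> \<beta> where \<alpha>\<beta>: "\<And>i. i \<in> I \<Longrightarrow> \<alpha> i \<in> carrier R" "\<And>i. i \<in> I \<Longrightarrow> \<beta> i \<in> carrier R"
    "\<And>i. i \<in> I \<Longrightarrow> p (e i) = \<alpha> i \<odot>\<^bsub>M\<^esub> x \<oplus>\<^bsub>M\<^esub> \<beta> i \<odot>\<^bsub>M\<^esub> y"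
    by metis
  \<comment> \<open>The sums run over any finite set that contains the support, so that the same set
    \<open>J\<close> serves for all vectors \<open>s m\<close>; the induction removes one index of
    the set at a time.\<close>
  have p_eq: "p v = (\<Oplus>i\<in>J'. v i \<otimes> \<alpha> i) \<odot>\<^bsub>M\<^esub> x \<oplus>\<^bsub>M\<^esub> (\<Oplus>i\<in>J'. v i \<otimes> \<beta> i) \<odot>\<^bsub>M\<^esub> y"
    if "finite J'" "J' \<subseteq> I" "v \<in> carrier (free_module R I)" "\<And>i. i \<notin> J' \<Longrightarrow> v i = \<zero>" for J' v
    using that
  proof (induction J' arbitrary: v rule: finite_induct)
    case empty
    \<comment> \<open>The definition of \<open>linear_maps\<close> has no clause for zero, so p v =
      0 is obtained from compatibility with the scalar zero.\<close>
    then have "v = (\<lambda>i. \<zero> \<otimes> v i)" by (auto simp: fun_eq_iff)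
    then have "p v = p (\<zero> \<odot>\<^bsub>free_module R I\<^esub> v)" by simp
    also have "\<dots> = \<zero> \<odot>\<^bsub>M\<^esub> p v"
      using empty.prems(2) by (rule linear_mapsD(3)[OF p R.zero_closed])
    also have "\<dots> = \<zero>\<^bsub>M\<^esub>"
      using linear_mapsD(1)[OF p empty.prems(2)] by (rule smult_l_null)
    finally show ?case using xy by simp
  next
    case (insert j J')
    define w where "w = v(j := \<zero>)"
    have vI: "v i \<in> carrier R" if "i \<in> I" for i
      using insert.prems(2) that by (simp add: free)
    have j: "j \<in> I" using insert.prems by auto
    have "{i. w i \<noteq> \<zero>} \<subseteq> {i. v i \<noteq> \<zero>}"
      by (auto simp: w_def)
    then have w: "w \<in> carrier (free_module R I)"
      using insert.prems(2) by (auto simp: free w_def intro: finite_subset)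
    have w0: "w i = \<zero>" if "i \<notin> J'" for i
      using that insert.prems(3)[of i] by (simp add: w_def)
    have sums: "(\<Oplus>i\<in>J'. w i \<otimes> \<gamma> i) = (\<Oplus>i\<in>J'. v i \<otimes> \<gamma> i)" "(\<Oplus>i\<in>J'. v i \<otimes> \<gamma> i) \<in> carrier R"
      "(\<Oplus>i\<in>insert j J'. v i \<otimes> \<gamma> i) = v j \<otimes> \<gamma> j \<oplus> (\<Oplus>i\<in>J'. v i \<otimes> \<gamma> i)"
      if \<gamma>: "\<And>i. i \<in> I \<Longrightarrow> \<gamma> i \<in> carrier R" for \<gamma>
    proof -
      have c: "(\<lambda>i. v i \<otimes> \<gamma> i) \<in> J' \<rightarrow> carrier R"
        using insert.prems(1) vI \<gamma> by auto
      then show "(\<Oplus>i\<in>J'. v i \<otimes> \<gamma> i) \<in> carrier R"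
        by (rule R.finsum_closed)
      show "(\<Oplus>i\<in>J'. w i \<otimes> \<gamma> i) = (\<Oplus>i\<in>J'. v i \<otimes> \<gamma> i)"
        using c insert.hyps(2) by (intro R.finsum_cong') (auto simp: w_def)
      show "(\<Oplus>i\<in>insert j J'. v i \<otimes> \<gamma> i) = v j \<otimes> \<gamma> j \<oplus> (\<Oplus>i\<in>J'. v i \<otimes> \<gamma> i)"
        using c insert.hyps vI[OF j] \<gamma>[OF j] by (intro R.finsum_insert) auto
    qed
    have vj: "v j \<odot>\<^bsub>free_module R I\<^esub> e j \<in> carrier (free_module R I)"
      using vI[OF j] j by (auto simp: free e_def)
    have "v = v j \<odot>\<^bsub>free_module R I\<^esub> e j \<oplus>\<^bsub>free_module R I\<^esub> w"
    proof
      fix i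
      show "v i = (v j \<odot>\<^bsub>free_module R I\<^esub> e j \<oplus>\<^bsub>free_module R I\<^esub> w) i"
        using vI[OF j] vI[of i] insert.prems(2)
        by (cases "i \<in> I") (auto simp: e_def w_def free)
    qed
    then have "p v = p (v j \<odot>\<^bsub>free_module R I\<^esub> e j) \<oplus>\<^bsub>M\<^esub> p w"
      using linear_mapsD(2)[OF p vj w] by simp
    also have "p (v j \<odot>\<^bsub>free_module R I\<^esub> e j) = v j \<odot>\<^bsub>M\<^esub> (\<alpha> j \<odot>\<^bsub>M\<^esub> x \<oplus>\<^bsub>M\<^esub> \<beta> j \<odot>\<^bsub>M\<^esub> y)"
      using linear_mapsD(3)[OF p vI[OF j] e[OF j]] \<alpha>\<beta>(3)[OF j] by simp
    also have "p w = (\<Oplus>i\<in>J'. v i \<otimes> \<alpha> i) \<odot>\<^bsub>M\<^esub> x \<oplus>\<^bsub>M\<^esub> (\<Oplus>i\<in>J'. v i \<otimes> \<beta> i) \<odot>\<^bsub>M\<^esub> y"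
      using insert.IH[OF _ w w0] insert.prems(1) by (simp add: sums(1) \<alpha>\<beta>)
    finally show ?case
      using vI[OF j] j \<alpha>\<beta>(1,2) xy(1,2)
      by (simp add: sums(2,3) smult_l_distr smult_r_distr smult_assoc1 M.a_ac)
  qed
  define F where "F \<gamma> m = (\<Oplus>i\<in>J. s m i \<otimes> \<gamma> i)" for \<gamma> m
  have F: "F \<gamma> \<in> linear_maps R M (self_module R)" if \<gamma>: "\<And>i. i \<in> I \<Longrightarrow> \<gamma> i \<in> carrier R" for \<gamma>
  proof -
    have sI: "s m i \<in> carrier R" "\<gamma> i \<in> carrier R" if "m \<in> carrier M" "i \<in> J" for m i
      using sc[OF that(1)] J(2) \<gamma> that(2) by (auto simp: free)
    show ?thesis
    proof (rule linear_mapsI)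
      fix m assume "m \<in> carrier M"
      then show "F \<gamma> m \<in> carrier (self_module R)"
        using sI by (auto simp: F_def intro!: R.finsum_closed)
    next
      fix m n assume mn: "m \<in> carrier M" "n \<in> carrier M"
      then have "F \<gamma> (m \<oplus>\<^bsub>M\<^esub> n) = (\<Oplus>i\<in>J. s m i \<otimes> \<gamma> i \<oplus> s n i \<otimes> \<gamma> i)"
        unfolding F_def by (intro R.finsum_cong')
          (auto simp: linear_mapsD(2)[OF s] sI l_distr)
      also have "\<dots> = F \<gamma> m \<oplus> F \<gamma> n"
        unfolding F_def using mn sI by (intro R.finsum_addf) auto
      finally show "F \<gamma> (m \<oplus>\<^bsub>M\<^esub> n) = F \<gamma> m \<oplus>\<^bsub>self_module R\<^esub> F \<gamma> n" by simp
    next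
      fix a m assume am: "a \<in> carrier R" "m \<in> carrier M"
      then have "F \<gamma> (a \<odot>\<^bsub>M\<^esub> m) = (\<Oplus>i\<in>J. a \<otimes> (s m i \<otimes> \<gamma> i))"
        unfolding F_def by (intro R.finsum_cong')
          (auto simp: linear_mapsD(3)[OF s] sI m_assoc)
      also have "\<dots> = a \<otimes> F \<gamma> m"
        unfolding F_def using am sI J(1) by (intro R.finsum_rdistr[symmetric]) auto
      finally show "F \<gamma> (a \<odot>\<^bsub>M\<^esub> m) = a \<odot>\<^bsub>self_module R\<^esub> F \<gamma> m" by simp
    qed
  qed
  show thesis
  proof (rule that)
    fix m assume m: "m \<in> carrier M"
    show "F \<alpha> m \<odot>\<^bsub>M\<^esub> x \<oplus>\<^bsub>M\<^esub> F \<beta> m \<odot>\<^bsub>M\<^esub> y = m"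
      using p_eq[OF J sc[OF m] supp[OF m]] ps[OF m] by (simp add: F_def)
  qed (rule F, rule \<alpha>\<beta>, assumption)+
qed

lemma free_module_module:
  fixes R (structure)
  assumes "cring R" "finite I"
  shows "module R (free_module R I)"
proof -
  interpret cring R by fact
  note carrier = free_module_carrier_finite[OF assms(2)]
  show ?thesis
  proof (rule moduleI)
    show "abelian_group (free_module R I)"
    proof (rule abelian_groupI)
      fix v assume v: "v \<in> carrier (free_module R I)"
      have "v i \<in> carrier R" for i
        using v by (cases "i \<in> I") (auto simp: carrier)
      then have "(\<lambda>i. \<ominus> v i) \<in> carrier (free_module R I)"
        "(\<lambda>i. \<ominus> v i) \<oplus>\<^bsub>free_module R I\<^esub> v = \<zero>\<^bsub>free_module R I\<^esub>"
        using v by (simp_all add: carrier l_neg)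
      then show "\<exists>w\<in>carrier (free_module R I). w \<oplus>\<^bsub>free_module R I\<^esub> v = \<zero>\<^bsub>free_module R I\<^esub>"
        by blast
    next
      fix u v w
      assume "u \<in> carrier (free_module R I)" "v \<in> carrier (free_module R I)"
        "w \<in> carrier (free_module R I)"
      then have c: "u i \<in> carrier R" "v i \<in> carrier R" "w i \<in> carrier R" for i
        by (cases "i \<in> I"; auto simp: carrier)+
      show "u \<oplus>\<^bsub>free_module R I\<^esub> v \<oplus>\<^bsub>free_module R I\<^esub> w =
          u \<oplus>\<^bsub>free_module R I\<^esub> (v \<oplus>\<^bsub>free_module R I\<^esub> w)"
        using c by (simp add: a_assoc)
    next
      fix u v
      assume "u \<in> carrier (free_module R I)" "v \<in> carrier (free_module R I)"
      then have c: "u i \<in> carrier R" "v i \<in> carrier R" for i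
        by (cases "i \<in> I"; auto simp: carrier)+
      show "u \<oplus>\<^bsub>free_module R I\<^esub> v = v \<oplus>\<^bsub>free_module R I\<^esub> u"
        using c by (simp add: a_comm)
    next
      fix v assume "v \<in> carrier (free_module R I)"
      then have "v i \<in> carrier R" for i
        by (cases "i \<in> I") (auto simp: carrier)
      then show "\<zero>\<^bsub>free_module R I\<^esub> \<oplus>\<^bsub>free_module R I\<^esub> v = v"
        by simp
    qed (auto simp: carrier)
  next
    fix a b v w
    assume ab: "a \<in> carrier R" "b \<in> carrier R"
      and v: "v \<in> carrier (free_module R I)" and w: "w \<in> carrier (free_module R I)"
    have c: "v i \<in> carrier R" "w i \<in> carrier R" for i
      using v w by (cases "i \<in> I"; auto simp: carrier)+
    show "(a \<oplus> b) \<odot>\<^bsub>free_module R I\<^esub> v =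
        a \<odot>\<^bsub>free_module R I\<^esub> v \<oplus>\<^bsub>free_module R I\<^esub> b \<odot>\<^bsub>free_module R I\<^esub> v"
      "a \<odot>\<^bsub>free_module R I\<^esub> (v \<oplus>\<^bsub>free_module R I\<^esub> w) =
        a \<odot>\<^bsub>free_module R I\<^esub> v \<oplus>\<^bsub>free_module R I\<^esub> a \<odot>\<^bsub>free_module R I\<^esub> w"
      "(a \<otimes> b) \<odot>\<^bsub>free_module R I\<^esub> v = a \<odot>\<^bsub>free_module R I\<^esub> (b \<odot>\<^bsub>free_module R I\<^esub> v)"
      using ab c by (simp_all add: l_distr r_distr m_assoc)
  next
    fix v assume "v \<in> carrier (free_module R I)"
    then have "v i \<in> carrier R" for i
      by (cases "i \<in> I") (auto simp: carrier)
    then show "\<one> \<odot>\<^bsub>free_module R I\<^esub> v = v" by simp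
  qed (auto simp: carrier is_cring)
qed

text \<open>The complement of a prime ideal is multiplicative and contains 1. The two conditions say
  that r |-> r g becomes surjective and injective, respectively, after localization at the
  prime.\<close>

lemma has_constant_rank_one_iff:
  fixes R (structure) and M :: "('a, 'm) module"
  assumes "module R M"
  shows "has_constant_rank R M 1 \<longleftrightarrow> (\<forall>P. primeideal P R \<longrightarrow> (\<exists>g\<in>carrier M.
      (\<forall>m\<in>carrier M. \<exists>t\<in>carrier R - P. \<exists>r\<in>carrier R. t \<odot>\<^bsub>M\<^esub> m = r \<odot>\<^bsub>M\<^esub> g) \<and>
      (\<forall>r\<in>carrier R. r \<odot>\<^bsub>M\<^esub> g = \<zero>\<^bsub>M\<^esub> \<longrightarrow> (\<exists>t\<in>carrier R - P. t \<otimes> r = \<zero>))))"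
proof -
  interpret module R M by fact
  have loc: "localization R M (carrier R - P)" if P: "primeideal P R" for P
  proof unfold_locales
    show "\<one> \<in> carrier R - P"
      using P ideal.one_imp_carrier[of P R] primeideal.axioms(1)[OF P] primeideal.I_notcarr[OF P]
      by auto
    show "s \<otimes> t \<in> carrier R - P" if "s \<in> carrier R - P" "t \<in> carrier R - P" for s t
      using that primeideal.I_prime[OF P] by blast
  qed auto
  show ?thesis
    unfolding has_constant_rank_def Let_def
    using localization.loc_module_free_rank_one_iff[OF loc] by simp
qed

section \<open>From a matrix to a projective module of rank one\<close>

context cring
begin

text \<open>Unimodularity enters twice. The coefficients \<open>x\<close>, \<open>y\<close>,
  \<open>z\<close>, \<open>w\<close> give functionals dual to the columns of A, and they prevent a
  prime ideal from containing all four entries. An entry outside the prime then serves as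
  denominator, and the column through it as local generator.\<close>

lemma Q_module_projective:
  assumes A: "A \<in> Um_det_zero R"
  shows "projective_of_rank R (Q_module R A) 1" "generated_by_two R (Q_module R A)"
proof -
  define a b c d where "a = A (0, 0)" and "b = A (0, 1)" and "c = A (1, 0)" and "d = A (1, 1)"
  obtain x y z w where A': "A \<in> carrier (mat_module R 2 2)"
    and abcd: "a \<in> carrier R" "b \<in> carrier R" "c \<in> carrier R" "d \<in> carrier R"
    and xyzw: "x \<in> carrier R" "y \<in> carrier R" "z \<in> carrier R" "w \<in> carrier R"
    and det: "a \<otimes> d = b \<otimes> c"
    and um: "a \<otimes> x \<oplus> b \<otimes> y \<oplus> (c \<otimes> z \<oplus> d \<otimes> w) = \<one>"
    using A unfolding a_def b_def c_def d_def by (rule Um_det_zeroE)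
  let ?F = "free_module R {..<2::nat}" and ?Q = "Q_module R A"
  interpret F: module R ?F
    by (rule free_module_module) (auto simp: is_cring)
  have "submodule (carrier ?Q) R ?F"
  proof (rule F.submoduleI)
    show sub: "carrier ?Q \<subseteq> carrier ?F"
      using A' by (rule Q_module_subset)
    show "\<zero>\<^bsub>?F\<^esub> \<in> carrier ?Q"
      using abcd by (auto simp: L_map_vec2[OF A'] vec2_zero a_def b_def c_def d_def
          intro!: image_eqI[of _ _ "vec2 R \<zero> \<zero>"])
    show add: "u \<oplus>\<^bsub>?F\<^esub> v \<in> carrier ?Q" if "u \<in> carrier ?Q" "v \<in> carrier ?Q" for u v
      using Q_module_closed(1)[OF A' that] by simp
    show smult: "r \<odot>\<^bsub>?F\<^esub> v \<in> carrier ?Q" if "r \<in> carrier R" "v \<in> carrier ?Q" for r v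
      using Q_module_closed(2)[OF A' that] by simp
    show "\<ominus>\<^bsub>?F\<^esub> v \<in> carrier ?Q" if "v \<in> carrier ?Q" for v
    proof -
      have "v \<in> carrier ?F"
        using that sub by (rule rev_subsetD)
      then have "\<ominus>\<^bsub>?F\<^esub> v = (\<ominus> \<one>) \<odot>\<^bsub>?F\<^esub> v"
        using F.smult_l_minus[of \<one> v] by (simp only: F.smult_one one_closed)
      then show ?thesis
        using smult[OF _ that, of "\<ominus> \<one>"] by simp
    qed
  qed
  from submodule.submodule_is_module[OF this F.module_axioms]
  interpret Q: module R ?Q
    by (simp add: Q_module_def)
  define X where "X = vec2 R a c"
  define Y where "Y = vec2 R b d"
  have L: "L_map R A (vec2 R s t) = vec2 R (a \<otimes> s \<oplus> b \<otimes> t) (c \<otimes> s \<oplus> d \<otimes> t)"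
    if "s \<in> carrier R" "t \<in> carrier R" for s t
    using that by (simp add: L_map_vec2[OF A'] a_def b_def c_def d_def)
  have XY: "X \<in> carrier ?Q" "Y \<in> carrier ?Q"
    using abcd L[of \<one> \<zero>] L[of \<zero> \<one>]
    by (auto simp: X_def Y_def intro: image_eqI[of _ _ "vec2 R \<one> \<zero>"] image_eqI[of _ _ "vec2 R \<zero> \<one>"])
  have QE: "\<exists>s\<in>carrier R. \<exists>t\<in>carrier R. v = vec2 R (a \<otimes> s \<oplus> b \<otimes> t) (c \<otimes> s \<oplus> d \<otimes> t)"
    if "v \<in> carrier ?Q" for v
  proof -
    from that obtain s t where "v = L_map R A (vec2 R s t)" "s \<in> carrier R" "t \<in> carrier R"
      by (auto elim: free2E)
    then show ?thesis by (metis L)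
  qed
  have comb: "s \<odot>\<^bsub>?Q\<^esub> X \<oplus>\<^bsub>?Q\<^esub> t \<odot>\<^bsub>?Q\<^esub> Y = vec2 R (s \<otimes> a \<oplus> t \<otimes> b) (s \<otimes> c \<oplus> t \<otimes> d)"
    if "s \<in> carrier R" "t \<in> carrier R" for s t
    using that by (simp add: X_def Y_def)
  define f where "f v = x \<otimes> v 0 \<oplus> z \<otimes> v 1" for v :: "nat \<Rightarrow> 'a"
  define g where "g v = y \<otimes> v 0 \<oplus> w \<otimes> v 1" for v :: "nat \<Rightarrow> 'a"
  have vc: "v 0 \<in> carrier R" "v (Suc 0) \<in> carrier R" if "v \<in> carrier ?Q" for v
    using subsetD[OF Q_module_subset[OF A'] that] by (auto simp: free2_carrier)
  have fg: "f \<in> linear_maps R ?Q (self_module R)" "g \<in> linear_maps R ?Q (self_module R)"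
    unfolding f_def g_def
    by (rule linear_mapsI; use vc xyzw in \<open>simp add: r_distr a_ac m_lcomm del: Q_module_simps(1)\<close>)+
  text \<open>Let \<open>B\<close> have rows \<open>(x, z)\<close> and \<open>(y, w)\<close>, so that \<open>tr (A B) = 1\<close>. Since \<open>det A = 0\<close> implies
    \<open>A B A = tr (A B) A\<close>, the matrix \<open>B\<close> maps an element of the image of \<open>A\<close> to coordinates with
    respect to the columns \<open>X\<close> and \<open>Y\<close>.\<close>
  have dual: "f v \<odot>\<^bsub>?Q\<^esub> X \<oplus>\<^bsub>?Q\<^esub> g v \<odot>\<^bsub>?Q\<^esub> Y = v" if v: "v \<in> carrier ?Q" for v
  proof -
    obtain s t where st: "s \<in> carrier R" "t \<in> carrier R"
      and v_eq: "v = vec2 R (a \<otimes> s \<oplus> b \<otimes> t) (c \<otimes> s \<oplus> d \<otimes> t)"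
      using QE[OF v] by blast
    have "f v \<otimes> a \<oplus> g v \<otimes> b = (a \<otimes> x \<oplus> b \<otimes> y) \<otimes> (a \<otimes> s \<oplus> b \<otimes> t) \<oplus>
        (a \<otimes> c \<otimes> z \<otimes> s \<oplus> (a \<otimes> d) \<otimes> z \<otimes> t \<oplus> (b \<otimes> c) \<otimes> w \<otimes> s \<oplus> b \<otimes> d \<otimes> w \<otimes> t)"
      unfolding f_def g_def v_eq vec2_simps One_nat_def using abcd xyzw st by algebra
    also have "a \<otimes> c \<otimes> z \<otimes> s \<oplus> (a \<otimes> d) \<otimes> z \<otimes> t \<oplus> (b \<otimes> c) \<otimes> w \<otimes> s \<oplus> b \<otimes> d \<otimes> w \<otimes> t =
        a \<otimes> c \<otimes> z \<otimes> s \<oplus> (b \<otimes> c) \<otimes> z \<otimes> t \<oplus> (a \<otimes> d) \<otimes> w \<otimes> s \<oplus> b \<otimes> d \<otimes> w \<otimes> t"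
      by (simp only: det)
    also have "(a \<otimes> x \<oplus> b \<otimes> y) \<otimes> (a \<otimes> s \<oplus> b \<otimes> t) \<oplus>
        (a \<otimes> c \<otimes> z \<otimes> s \<oplus> (b \<otimes> c) \<otimes> z \<otimes> t \<oplus> (a \<otimes> d) \<otimes> w \<otimes> s \<oplus> b \<otimes> d \<otimes> w \<otimes> t) =
        (a \<otimes> x \<oplus> b \<otimes> y \<oplus> (c \<otimes> z \<oplus> d \<otimes> w)) \<otimes> (a \<otimes> s \<oplus> b \<otimes> t)"
      using abcd xyzw st by algebra
    finally have 1: "f v \<otimes> a \<oplus> g v \<otimes> b = a \<otimes> s \<oplus> b \<otimes> t"
      using um abcd st by simp
    have "f v \<otimes> c \<oplus> g v \<otimes> d = (c \<otimes> z \<oplus> d \<otimes> w) \<otimes> (c \<otimes> s \<oplus> d \<otimes> t) \<oplus>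
        (a \<otimes> c \<otimes> x \<otimes> s \<oplus> (b \<otimes> c) \<otimes> x \<otimes> t \<oplus> (a \<otimes> d) \<otimes> y \<otimes> s \<oplus> b \<otimes> d \<otimes> y \<otimes> t)"
      unfolding f_def g_def v_eq vec2_simps One_nat_def using abcd xyzw st by algebra
    also have "a \<otimes> c \<otimes> x \<otimes> s \<oplus> (b \<otimes> c) \<otimes> x \<otimes> t \<oplus> (a \<otimes> d) \<otimes> y \<otimes> s \<oplus> b \<otimes> d \<otimes> y \<otimes> t =
        a \<otimes> c \<otimes> x \<otimes> s \<oplus> (a \<otimes> d) \<otimes> x \<otimes> t \<oplus> (b \<otimes> c) \<otimes> y \<otimes> s \<oplus> b \<otimes> d \<otimes> y \<otimes> t"
      by (simp only: det)
    also have "(c \<otimes> z \<oplus> d \<otimes> w) \<otimes> (c \<otimes> s \<oplus> d \<otimes> t) \<oplus>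
        (a \<otimes> c \<otimes> x \<otimes> s \<oplus> (a \<otimes> d) \<otimes> x \<otimes> t \<oplus> (b \<otimes> c) \<otimes> y \<otimes> s \<oplus> b \<otimes> d \<otimes> y \<otimes> t) =
        (a \<otimes> x \<oplus> b \<otimes> y \<oplus> (c \<otimes> z \<oplus> d \<otimes> w)) \<otimes> (c \<otimes> s \<oplus> d \<otimes> t)"
      using abcd xyzw st by algebra
    finally have 2: "f v \<otimes> c \<oplus> g v \<otimes> d = c \<otimes> s \<oplus> d \<otimes> t"
      using um abcd st by simp
    have "f v \<in> carrier R" "g v \<in> carrier R"
      using linear_mapsD(1)[OF fg(1) v] linear_mapsD(1)[OF fg(2) v] by simp_all
    then show ?thesis
      using comb 1 2 v_eq by simp
  qed
  have projective: "projective R ?Q"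
    using Q.module_axioms XY fg dual by (rule dual_basis_imp_projective)
  have "carrier ?Q \<subseteq> generated_submodule R ?Q {X, Y}"
  proof
    fix v assume v: "v \<in> carrier ?Q"
    have "f v \<in> carrier R" "g v \<in> carrier R"
      using linear_mapsD(1)[OF fg(1) v] linear_mapsD(1)[OF fg(2) v] by simp_all
    then show "v \<in> generated_submodule R ?Q {X, Y}"
      unfolding generated_submodule_pair[OF Q.module_axioms XY]
      using dual[OF v] by (metis (mono_tags, lifting) mem_Collect_eq)
  qed
  moreover have "generated_submodule R ?Q {X, Y} \<subseteq> carrier ?Q"
    unfolding generated_submodule_def using Q.carrier_is_submodule XY by blast
  ultimately have gen: "generated_submodule R ?Q {X, Y} = carrier ?Q"
    by blast
  with XY show "generated_by_two R ?Q"
    unfolding generated_by_two_def by blast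
  have fin: "finitely_generated R ?Q"
    unfolding finitely_generated_def using XY gen by (intro exI[of _ "{X, Y}"]) simp
  have "\<exists>h\<in>carrier ?Q.
      (\<forall>m\<in>carrier ?Q. \<exists>t\<in>carrier R - P. \<exists>r\<in>carrier R. t \<odot>\<^bsub>?Q\<^esub> m = r \<odot>\<^bsub>?Q\<^esub> h) \<and>
      (\<forall>r\<in>carrier R. r \<odot>\<^bsub>?Q\<^esub> h = \<zero>\<^bsub>?Q\<^esub> \<longrightarrow> (\<exists>t\<in>carrier R - P. t \<otimes> r = \<zero>))"
    if P: "primeideal P R" for P
  proof -
    \<comment> \<open>A common denominator \<open>t\<close> for the two columns suffices: t m = f m
      (t X) + g m (t Y) is then a multiple of \<open>h\<close>. The same \<open>t\<close> is used to
      kill the scalars that annihilate \<open>h\<close>.\<close>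
    have witness: ?thesis
      if h: "h \<in> carrier ?Q" and t: "t \<in> carrier R - P" and r: "r \<in> carrier R" "r' \<in> carrier R"
        and eqs: "t \<odot>\<^bsub>?Q\<^esub> X = r \<odot>\<^bsub>?Q\<^esub> h" "t \<odot>\<^bsub>?Q\<^esub> Y = r' \<odot>\<^bsub>?Q\<^esub> h"
        and tor: "\<And>r. r \<in> carrier R \<Longrightarrow> r \<odot>\<^bsub>?Q\<^esub> h = \<zero>\<^bsub>?Q\<^esub> \<Longrightarrow> t \<otimes> r = \<zero>" for h t r r'
    proof (intro bexI[OF _ h] conjI ballI impI)
      fix m assume m: "m \<in> carrier ?Q"
      have fgm: "f m \<in> carrier R" "g m \<in> carrier R"
        using linear_mapsD(1)[OF fg(1) m] linear_mapsD(1)[OF fg(2) m] by simp_all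
      have "t \<odot>\<^bsub>?Q\<^esub> m = f m \<odot>\<^bsub>?Q\<^esub> (t \<odot>\<^bsub>?Q\<^esub> X) \<oplus>\<^bsub>?Q\<^esub> g m \<odot>\<^bsub>?Q\<^esub> (t \<odot>\<^bsub>?Q\<^esub> Y)"
        using t fgm XY
        by (subst dual[OF m, symmetric])
          (simp add: Q.smult_r_distr Q.smult_assoc1[symmetric] m_comm del: Q_module_simps)
      also have "\<dots> = (f m \<otimes> r \<oplus> g m \<otimes> r') \<odot>\<^bsub>?Q\<^esub> h"
        unfolding eqs using fgm r h
        by (simp add: Q.smult_l_distr Q.smult_assoc1 del: Q_module_simps)
      finally show "\<exists>t\<in>carrier R - P. \<exists>r\<in>carrier R. t \<odot>\<^bsub>?Q\<^esub> m = r \<odot>\<^bsub>?Q\<^esub> h"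
        using t r fgm by blast
    qed (use t tor in blast)
    have "a \<notin> P \<or> b \<notin> P \<or> c \<notin> P \<or> d \<notin> P"
    proof (rule ccontr)
      interpret P: primeideal P R by fact
      assume "\<not> ?thesis"
      then have "a \<otimes> x \<oplus> b \<otimes> y \<oplus> (c \<otimes> z \<oplus> d \<otimes> w) \<in> P"
        using xyzw by (simp add: P.I_r_closed)
      then show False
        using um P.one_imp_carrier P.I_notcarr by simp
    qed
    then consider "a \<in> carrier R - P" | "b \<in> carrier R - P" | "c \<in> carrier R - P" | "d \<in> carrier R - P"
      using abcd by blast
    then show ?thesis
    proof cases
      \<comment> \<open>From a d = b c one gets a Y = b X, and r X = 0 includes r a = 0. The other
        cases rest likewise on b X = a Y, c Y = d X and d X = c Y.\<close>
      case 1
      show ?thesis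
        by (rule witness[OF XY(1) 1 abcd(1,2)])
          (use abcd det in \<open>auto simp: X_def Y_def vec2_zero m_ac\<close>)
    next
      case 2
      show ?thesis
        by (rule witness[OF XY(2) 2 abcd(1,2)])
          (use abcd det in \<open>auto simp: X_def Y_def vec2_zero m_ac\<close>)
    next
      case 3
      show ?thesis
        by (rule witness[OF XY(1) 3 abcd(3,4)])
          (use abcd det in \<open>auto simp: X_def Y_def vec2_zero m_ac\<close>)
    next
      case 4
      show ?thesis
        by (rule witness[OF XY(2) 4 abcd(3,4)])
          (use abcd det in \<open>auto simp: X_def Y_def vec2_zero m_ac\<close>)
    qed
  qed
  then have "has_constant_rank R ?Q 1"
    unfolding has_constant_rank_one_iff[OF Q.module_axioms] by blast
  with projective fin show "projective_of_rank R ?Q 1"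
    by (simp add: projective_of_rank_def)
qed

end

section \<open>From a projective module of rank one to a matrix\<close>

lemma projective_rank_one_iso_Q_module:
  fixes R (structure) and M :: "('a, 'm) module"
  assumes M: "projective_of_rank R M 1" and gen: "generated_by_two R M"
  shows "\<exists>A\<in>Um_det_zero R. module_iso R M (Q_module R A)"
proof -
  have proj: "projective R M" and rank: "has_constant_rank R M 1"
    using M by (auto simp: projective_of_rank_def)
  interpret module R M
    using proj by (simp add: projective_def)
  obtain x y where xy: "x \<in> carrier M" "y \<in> carrier M" "generated_submodule R M {x, y} = carrier M"
    using gen unfolding generated_by_two_def by blast
  obtain f g where f: "f \<in> linear_maps R M (self_module R)" and g: "g \<in> linear_maps R M (self_module R)"
    and dual: "\<And>m. m \<in> carrier M \<Longrightarrow> f m \<odot>\<^bsub>M\<^esub> x \<oplus>\<^bsub>M\<^esub> g m \<odot>\<^bsub>M\<^esub> y = m"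
    using projective_imp_dual_basis[OF proj xy] by blast
  note fD = linear_mapsD[OF f, simplified] and gD = linear_mapsD[OF g, simplified]
  \<comment> \<open>These are the entries of the idempotent of R^2 that sends (s, t) to the pair of
    values of \<open>f\<close> and \<open>g\<close> at s x + t y.\<close>
  define a b c d where "a = f x" and "b = f y" and "c = g x" and "d = g y"
  have abcd: "a \<in> carrier R" "b \<in> carrier R" "c \<in> carrier R" "d \<in> carrier R"
    using fD(1) gD(1) xy by (simp_all add: a_def b_def c_def d_def)
  have local: "\<exists>t\<in>carrier R - P. t \<otimes> (a \<otimes> d \<ominus> b \<otimes> c) = \<zero>"
    "\<exists>t\<in>carrier R - P. t \<otimes> (\<one> \<ominus> (a \<oplus> d)) = \<zero>" if P: "primeideal P R" for P
  proof -
    obtain h where h: "h \<in> carrier M"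
      "\<forall>m\<in>carrier M. \<exists>t\<in>carrier R - P. \<exists>r\<in>carrier R. t \<odot>\<^bsub>M\<^esub> m = r \<odot>\<^bsub>M\<^esub> h"
      "\<forall>r\<in>carrier R. r \<odot>\<^bsub>M\<^esub> h = \<zero>\<^bsub>M\<^esub> \<longrightarrow> (\<exists>t\<in>carrier R - P. t \<otimes> r = \<zero>)"
      using mp[OF spec[OF iffD1[OF has_constant_rank_one_iff[OF module_axioms] rank]] P]
      by (elim bexE conjE) (rule that)
    have prime: "s \<otimes> t \<in> carrier R - P" if "s \<in> carrier R - P" "t \<in> carrier R - P" for s t
      using that primeideal.I_prime[OF P] by blast
    obtain t1 r1 where 1: "t1 \<in> carrier R - P" "r1 \<in> carrier R" "t1 \<odot>\<^bsub>M\<^esub> x = r1 \<odot>\<^bsub>M\<^esub> h"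
      using bspec[OF h(2) xy(1)] by blast
    obtain t2 r2 where 2: "t2 \<in> carrier R - P" "r2 \<in> carrier R" "t2 \<odot>\<^bsub>M\<^esub> y = r2 \<odot>\<^bsub>M\<^esub> h"
      using bspec[OF h(2) xy(2)] by blast
    \<comment> \<open>With the common denominator \<open>t\<close> both generators become multiples
      of the local generator: t x = r h and t y = s h. Applying \<open>f\<close> and
      \<open>g\<close> shows that t A is the product of the column (p, q) and the row (r,
      s).\<close>
    define t where "t = t1 \<otimes> t2"
    define r where "r = t2 \<otimes> r1"
    define s where "s = t1 \<otimes> r2"
    define p where "p = f h"
    define q where "q = g h"
    have t: "t \<in> carrier R - P" "t \<in> carrier R"
      using prime 1 2 by (auto simp: t_def)
    have c: "r \<in> carrier R" "s \<in> carrier R" "p \<in> carrier R" "q \<in> carrier R"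
      using 1 2 h(1) fD(1) gD(1) by (simp_all add: r_def s_def p_def q_def)
    have "t \<odot>\<^bsub>M\<^esub> x = t2 \<odot>\<^bsub>M\<^esub> (t1 \<odot>\<^bsub>M\<^esub> x)" "t \<odot>\<^bsub>M\<^esub> y = t1 \<odot>\<^bsub>M\<^esub> (t2 \<odot>\<^bsub>M\<^esub> y)"
      using 1(1) 2(1) xy by (simp_all add: t_def smult_assoc1[symmetric] m_comm)
    then have tx: "t \<odot>\<^bsub>M\<^esub> x = r \<odot>\<^bsub>M\<^esub> h" and ty: "t \<odot>\<^bsub>M\<^esub> y = s \<odot>\<^bsub>M\<^esub> h"
      using 1 2 h(1) by (simp_all add: r_def s_def smult_assoc1)
    have ta: "t \<otimes> a = r \<otimes> p" and tb: "t \<otimes> b = s \<otimes> p" and tc: "t \<otimes> c = r \<otimes> q" and td: "t \<otimes> d = s \<otimes> q"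
      using arg_cong[OF tx, of f] arg_cong[OF ty, of f] arg_cong[OF tx, of g] arg_cong[OF ty, of g]
        t(2) c h(1) xy
      by (simp_all add: fD(3) gD(3) a_def b_def c_def d_def p_def q_def)
    have "t \<otimes> t \<otimes> (a \<otimes> d \<ominus> b \<otimes> c) = (t \<otimes> a) \<otimes> (t \<otimes> d) \<ominus> (t \<otimes> b) \<otimes> (t \<otimes> c)"
      using t(2) abcd by algebra
    also have "\<dots> = \<zero>"
      unfolding ta tb tc td using c by algebra
    finally show "\<exists>t\<in>carrier R - P. t \<otimes> (a \<otimes> d \<ominus> b \<otimes> c) = \<zero>"
      using prime[OF t(1) t(1)] by blast
    \<comment> \<open>Expanding \<open>h\<close> in the dual basis gives t h = (r p + s q) h, and r
      p + s q = t (a + d). Thus t (1 - tr A) kills \<open>h\<close>, and the torsion condition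
      supplies a further denominator \<open>u\<close>.\<close>
    have "t \<odot>\<^bsub>M\<^esub> h = t \<odot>\<^bsub>M\<^esub> (p \<odot>\<^bsub>M\<^esub> x \<oplus>\<^bsub>M\<^esub> q \<odot>\<^bsub>M\<^esub> y)"
      using dual[OF h(1)] by (simp add: p_def q_def)
    also have "\<dots> = p \<odot>\<^bsub>M\<^esub> (t \<odot>\<^bsub>M\<^esub> x) \<oplus>\<^bsub>M\<^esub> q \<odot>\<^bsub>M\<^esub> (t \<odot>\<^bsub>M\<^esub> y)"
      using t(2) c xy by (simp add: smult_r_distr smult_assoc1[symmetric] m_comm)
    also have "\<dots> = (r \<otimes> p \<oplus> s \<otimes> q) \<odot>\<^bsub>M\<^esub> h"
      unfolding tx ty using c h(1) by (simp add: smult_l_distr smult_assoc1[symmetric] m_comm)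
    finally have zero: "(t \<ominus> (r \<otimes> p \<oplus> s \<otimes> q)) \<odot>\<^bsub>M\<^esub> h = \<zero>\<^bsub>M\<^esub>"
      using t(2) c h(1) by (simp add: R.minus_eq smult_l_distr smult_l_minus M.r_neg)
    have "t \<ominus> (r \<otimes> p \<oplus> s \<otimes> q) \<in> carrier R"
      using t(2) c by simp
    from bspec[OF h(3) this] zero
    obtain u where u: "u \<in> carrier R - P" "u \<otimes> (t \<ominus> (r \<otimes> p \<oplus> s \<otimes> q)) = \<zero>"
      by blast
    have "u \<otimes> t \<otimes> (\<one> \<ominus> (a \<oplus> d)) = u \<otimes> (t \<ominus> (t \<otimes> a \<oplus> t \<otimes> d))"
      using u(1) t(2) abcd by (simp add: R.minus_eq R.r_distr R.r_minus R.minus_add m_assoc)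
    also have "\<dots> = \<zero>"
      using u(2) by (simp add: ta td)
    finally show "\<exists>t\<in>carrier R - P. t \<otimes> (\<one> \<ominus> (a \<oplus> d)) = \<zero>"
      using prime[OF u(1) t(1)] by blast
  qed
  have det: "a \<otimes> d \<ominus> b \<otimes> c = \<zero>"
    using abcd by (intro locally_zero_imp_zero local(1)) simp_all
  have "\<one> \<ominus> (a \<oplus> d) = \<zero>"
    using abcd by (intro locally_zero_imp_zero local(2)) simp_all
  then have trace: "a \<oplus> d = \<one>"
    using abcd by - (rule R.diff_zero_imp_eq[symmetric], simp_all)
  define A where "A = (\<lambda>(i, j::nat). vec2 R (vec2 R a b j) (vec2 R c d j) i)"
  have A_simps: "A (0, 0) = a" "A (0, Suc 0) = b" "A (Suc 0, 0) = c" "A (Suc 0, Suc 0) = d"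
    by (simp_all add: A_def)
  have A: "A \<in> carrier (mat_module R 2 2)"
    using abcd by (auto simp: mat_module_carrier A_def less_2_cases_iff vec2_def)
  have "mat_det R 2 A = \<zero>"
    using A det by (subst mat_det_2) (auto simp: mat_module_carrier A_simps)
  moreover have "A \<in> Um R (mat_module R 2 2)"
    \<comment> \<open>The coefficients 1, 0, 0, 1 are those of the trace, which is a functional with
      value 1 at A.\<close>
    unfolding Um_mat_iff[OF A] using abcd trace
    by - (rule bexI[of _ \<one>], rule bexI[of _ \<zero>], rule bexI[of _ \<zero>], rule bexI[of _ \<one>],
        simp_all add: A_simps)
  ultimately have "A \<in> Um_det_zero R"
    by (simp add: Um_det_zero_def)
  moreover have "module_iso R M (Q_module R A)"
    unfolding module_iso_def
  proof (intro bexI linear_mapsI)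
    let ?h = "\<lambda>m. vec2 R (f m) (g m)"
    have comb: "f (s \<odot>\<^bsub>M\<^esub> x \<oplus>\<^bsub>M\<^esub> t \<odot>\<^bsub>M\<^esub> y) = a \<otimes> s \<oplus> b \<otimes> t"
        "g (s \<odot>\<^bsub>M\<^esub> x \<oplus>\<^bsub>M\<^esub> t \<odot>\<^bsub>M\<^esub> y) = c \<otimes> s \<oplus> d \<otimes> t" if "s \<in> carrier R" "t \<in> carrier R" for s t
      using that xy fD(1) gD(1)
      by (simp_all add: fD(2,3) gD(2,3) a_def b_def c_def d_def m_comm)
    have L: "L_map R A (vec2 R s t) = ?h (s \<odot>\<^bsub>M\<^esub> x \<oplus>\<^bsub>M\<^esub> t \<odot>\<^bsub>M\<^esub> y)"
      if "s \<in> carrier R" "t \<in> carrier R" for s t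
      using that by (simp add: L_map_vec2[OF A] A_simps comb)
    \<comment> \<open>The vector (f m, g m) is fixed by the idempotent A, because its entries are
      coefficients of m in terms of \<open>x\<close> and \<open>y\<close>; so it is its own
      preimage.\<close>
    show closed: "?h m \<in> carrier (Q_module R A)" if "m \<in> carrier M" for m
      using L[OF fD(1) gD(1), OF that that] dual[OF that] fD(1)[OF that] gD(1)[OF that]
      by (auto intro: image_eqI[of _ _ "?h m"])
    show "bij_betw ?h (carrier M) (carrier (Q_module R A))"
    proof (rule bij_betwI')
      fix m n assume m: "m \<in> carrier M" and n: "n \<in> carrier M"
      have "m = n" if "f m = f n" "g m = g n"
        using dual[OF m] dual[OF n] unfolding that by (metis (no_types))
      then show "(?h m = ?h n) = (m = n)"
        unfolding vec2_eq_iff by blast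
    next
      fix v assume "v \<in> carrier (Q_module R A)"
      then obtain s t where st: "s \<in> carrier R" "t \<in> carrier R" "v = L_map R A (vec2 R s t)"
        by (auto elim: free2E)
      then show "\<exists>m\<in>carrier M. v = ?h m"
        using xy by (intro bexI[of _ "s \<odot>\<^bsub>M\<^esub> x \<oplus>\<^bsub>M\<^esub> t \<odot>\<^bsub>M\<^esub> y"]) (simp_all add: L)
    qed (rule closed)
  qed (simp_all add: fD gD)
  ultimately show ?thesis by blast
qed

section \<open>The conditions on the whole ring\<close>

lemma (in cring) Pi2_ring_iff_non_full:
  "Pi2_ring R \<longleftrightarrow> (\<forall>A\<in>Um_det_zero R. non_full R A)"
  using is_cring non_full_equivalences(1) by (auto simp: Pi2_ring_def)

text \<open>The elements of \<open>M\<close> may be of any type: the isomorphism with some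
  \<open>Q_module R A\<close> moves the question into R^2.\<close>

lemma (in cring) Pi2_ring_imp_iso_self:
  fixes M :: "('a, 'm) module"
  assumes "Pi2_ring R" "projective_of_rank R M 1" "generated_by_two R M"
  shows "module_iso R M (self_module R)"
proof -
  obtain A where A: "A \<in> Um_det_zero R" "module_iso R M (Q_module R A)"
    using projective_rank_one_iso_Q_module[OF assms(2,3)] by blast
  have "module_iso R (Q_module R A) (self_module R)"
    using A(1) assms(1) non_full_equivalences(4) Pi2_ring_iff_non_full by blast
  with A(2) show ?thesis
    by (rule module_iso_trans)
qed

theorem theorem1p5:
  fixes R :: "('a, 'r) ring_scheme"
  assumes "cring R"
  shows
    "(Pi2_ring R \<longleftrightarrow> (\<forall>A\<in>Um_det_zero R. non_full R A)) \<and>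
     (Pi2_ring R \<longleftrightarrow>
        (\<forall>A\<in>Um_det_zero R. module_iso R (K_module R A) (self_module R) \<or>
                            module_iso R (Q_module R A) (self_module R))) \<and>
     (Pi2_ring R \<longleftrightarrow>
        (\<forall>M :: ('a, nat \<Rightarrow> 'a) module.
           projective_of_rank R M 1 \<and> generated_by_two R M \<longrightarrow> module_iso R M (self_module R))) \<and>
     (Pi2_ring R \<longrightarrow>
        (\<forall>M :: ('a, 'm) module.
           projective_of_rank R M 1 \<and> generated_by_two R M \<longrightarrow> module_iso R M (self_module R))) \<and>
     (\<forall>A\<in>Um_det_zero R. non_full R A \<longleftrightarrow> factors_through_R R A) \<and>
     (\<forall>A\<in>Um_det_zero R. module_iso R (K_module R A) (self_module R) \<longleftrightarrow>
                       module_iso R (Q_module R A) (self_module R))"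
proof -
  interpret cring R by fact
  note eqs = non_full_equivalences
  note non_full = Pi2_ring_iff_non_full
  \<comment> \<open>The modules \<open>Q_module R A\<close> have elements of type
    \<open>nat \<Rightarrow> 'a\<close>, so the hypothesis on modules of this one element type
    already reaches every matrix in \<open>Um_det_zero R\<close>.\<close>
  have Pi2: "Pi2_ring R"
    if "\<forall>M :: ('a, nat \<Rightarrow> 'a) module. projective_of_rank R M 1 \<and> generated_by_two R M \<longrightarrow>
      module_iso R M (self_module R)"
    using that Q_module_projective eqs(4) non_full by blast
  show ?thesis
    using non_full eqs(2-4) Pi2
      Pi2_ring_imp_iso_self[where 'm = "nat \<Rightarrow> 'a"] Pi2_ring_imp_iso_self[where 'm = 'm]
    by blast
qed

end
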